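(* Let $G$ be a finite simple graph of order $n$. Then (a) $\gamma_s'(G)\le n+v_{odd}(G)/2$; (b) if $v_{even}(G)>0$, then $\gamma_s'(G)\le n-2+v_{even}(G)$; and consequently $\gamma_s'(G)\le (4n-2)/3$.
   Context: For a simple graph $G=(V,E)$ and an edge $e=uv$, let $N[e]=E_G(u)\cup E_G(v)$, where $E_G(x)$ is the set of edges of $G$ incident with $x$. A signed edge domination function (SEDF) of $G$ is a function $f:E\to\{1,-1\}$ such that $\sum_{e'\in N[e]}f(e')\ge 1$ for every $e\in E$. The signed edge domination number $\gamma_s'(G)$ is the minimum of $f(G)=\sum_{e\in E}f(e)$ over all SEDFs $f$ of $G$. A vertex is odd (resp. even) if its degree is odd (resp. even); $v_{odd}(G)$ and $v_{even}(G)$ denote the numbers of odd and even vertices of $G$. *)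

theory Defs
  imports Complex_Main
begin

definition simple_graph :: "'a set \<Rightarrow> 'a set set \<Rightarrow> bool" where
  "simple_graph V E \<longleftrightarrow> finite V \<and> (\<forall>e\<in>E. e \<subseteq> V \<and> card e = 2)"

definition inc_edges :: "'a set set \<Rightarrow> 'a \<Rightarrow> 'a set set" where
  "inc_edges E x = {e \<in> E. x \<in> e}"

definition degree :: "'a set set \<Rightarrow> 'a \<Rightarrow> nat" where
  "degree E x = card (inc_edges E x)"

definition closed_edge_nbhd :: "'a set set \<Rightarrow> 'a set \<Rightarrow> 'a set set" where
  "closed_edge_nbhd E e = (\<Union>x\<in>e. inc_edges E x)"

definition is_SEDF :: "'a set set \<Rightarrow> ('a set \<Rightarrow> int) \<Rightarrow> bool" where
  "is_SEDF E f \<longleftrightarrow> (\<forall>e\<in>E. f e = 1 \<or> f e = -1)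
      \<and> (\<forall>e\<in>E. (\<Sum>e'\<in>closed_edge_nbhd E e. f e') \<ge> 1)"

definition signed_edge_dom_num :: "'a set set \<Rightarrow> int" where
  "signed_edge_dom_num E = Min {(\<Sum>e\<in>E. f e) | f. is_SEDF E f}"

definition v_odd :: "'a set \<Rightarrow> 'a set set \<Rightarrow> nat" where
  "v_odd V E = card {v \<in> V. odd (degree E v)}"

definition v_even :: "'a set \<Rightarrow> 'a set set \<Rightarrow> nat" where
  "v_even V E = card {v \<in> V. even (degree E v)}"

end

theory Submission
  imports Defs
begin

text \<open>
  Write S(v) for the sum of f over the edges at v. A signing f is an SEDF iff f(uv) < S(u) + S(v)
  for every edge uv. Join all odd vertices of G to a new vertex None, so that the augmented graph
  is even, and walk along Euler circuits starting at None where possible.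

  For the bound with the odd vertices, sign a circuit greedily: whenever a vertex is reached
  along a positive edge for the first time, choose it and leave it along a positive edge again;
  otherwise alternate. Then exactly the chosen vertices have sum 2 and every positive edge has a
  chosen end. Deleting None changes the sums by 1, and the resulting defects are repaired by turning
  some negative edges positive.

  For the bound with the even vertices, alternate the signs along the circuits. Every vertex then
  has sum 0 or -1 or 1, up to one even vertex with sum 2 per odd component, and making one negative edge at
  each deficient vertex positive costs n + v_even in total. The final saving of 2 comes from an
  isolated vertex, from one negative edge serving two deficient vertices, or from a deficient even
  vertex that needs no repair.
\<close>

section \<open>Euler circuits\<close>

text \<open>The obstacle is the vertex where a circuit closes: its sum receives the signs of the
  first and the last edge, and the last one cannot be prescribed. Starting at \<open>None\<close>
  moves this defect to a vertex that is deleted afterwards, which serves every component with an odd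
  vertex. A component with even vertices only has to carry the defect itself; hence the roots of sum
  2 in one bound and the separate treatment of such components in the other.

  The constants come from half the vertex sums plus 2 for each repair. With alternating signs an odd
  vertex contributes 1/2 or -1/2; the second kind needs a repair and makes up at most half of the
  odd vertices, so an odd vertex costs at most 1 on average and an even one at most 2. This is n +
  v_even. With greedy signs let C be the chosen vertices of G and P the odd vertices whose edge to
  \<open>None\<close> is positive. Deleting \<open>None\<close> leaves the total |C| - |P| +
  v_odd/2, so n - |C| + |P| is available for repairs.\<close>

definition two_sets :: "'a set set \<Rightarrow> bool" where
  "two_sets E \<longleftrightarrow> finite E \<and> (\<forall>e\<in>E. card e = 2)"

definition vsum :: "'a set set \<Rightarrow> ('a set \<Rightarrow> int) \<Rightarrow> 'a \<Rightarrow> int" where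
  "vsum E f v = sum f (inc_edges E v)"

definition even_graph :: "'a set set \<Rightarrow> bool" where
  "even_graph E \<longleftrightarrow> (\<forall>v. even (degree E v))"

text \<open>The closed subsets are the unions of edge sets of components, so components can be split
  off without a notion of connectivity.\<close>

definition closed_in :: "'a set set \<Rightarrow> 'a set set \<Rightarrow> bool" where
  "closed_in K E \<longleftrightarrow> K \<subseteq> E \<and> (\<forall>e\<in>E. e \<inter> \<Union>K \<noteq> {} \<longrightarrow> e \<in> K)"

lemma two_setsD: "two_sets E \<Longrightarrow> finite E" "two_sets E \<Longrightarrow> e \<in> E \<Longrightarrow> card e = 2"
  by (auto simp: two_sets_def)

lemma two_sets_subset: "two_sets E \<Longrightarrow> F \<subseteq> E \<Longrightarrow> two_sets F"
  by (auto simp: two_sets_def intro: finite_subset)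

lemma two_sets_pair: "two_sets E \<Longrightarrow> {u, v} \<in> E \<Longrightarrow> u \<noteq> v"
  by (auto simp: two_sets_def)

lemma two_sets_obtain:
  assumes "two_sets E" "e \<in> E" "u \<in> e"
  obtains v where "e = {u, v}" "u \<noteq> v"
  using two_setsD(2)[OF assms(1,2)] assms(3) by (auto simp: card_2_iff)

lemma finite_inc_edges: "finite E \<Longrightarrow> finite (inc_edges E v)"
  by (simp add: inc_edges_def)

lemma inc_edges_Un: "inc_edges (A \<union> B) v = inc_edges A v \<union> inc_edges B v"
  by (auto simp: inc_edges_def)

lemma inc_edges_insert:
  "inc_edges (insert e A) v = (if v \<in> e then insert e (inc_edges A v) else inc_edges A v)"
  by (auto simp: inc_edges_def)

lemma inc_edges_empty [simp]: "inc_edges {} v = {}"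
  by (simp add: inc_edges_def)

lemma vsum_empty [simp]: "vsum {} f v = 0"
  by (simp add: vsum_def)

lemma vsum_insert:
  "finite A \<Longrightarrow> e \<notin> A \<Longrightarrow> vsum (insert e A) f v = (if v \<in> e then f e else 0) + vsum A f v"
  by (simp add: vsum_def inc_edges_insert finite_inc_edges) (simp add: inc_edges_def)

lemma vsum_Un:
  "finite A \<Longrightarrow> finite B \<Longrightarrow> A \<inter> B = {} \<Longrightarrow> vsum (A \<union> B) f v = vsum A f v + vsum B f v"
  unfolding vsum_def inc_edges_Un
  by (rule sum.union_disjoint) (auto simp: inc_edges_def)

lemma vsum_cong: "(\<And>e. e \<in> E \<Longrightarrow> v \<in> e \<Longrightarrow> f e = g e) \<Longrightarrow> vsum E f v = vsum E g v"
  by (auto simp: vsum_def inc_edges_def intro: sum.cong)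

lemma degree_vsum: "int (degree E v) = vsum E (\<lambda>_. 1) v"
  by (simp add: degree_def vsum_def)

lemma degree_Un:
  "finite A \<Longrightarrow> finite B \<Longrightarrow> A \<inter> B = {} \<Longrightarrow> degree (A \<union> B) v = degree A v + degree B v"
  by (metis degree_vsum vsum_Un of_nat_add of_nat_eq_iff)

lemma degree_insert:
  "finite A \<Longrightarrow> e \<notin> A \<Longrightarrow> degree (insert e A) v = (if v \<in> e then 1 else 0) + degree A v"
  by (simp add: degree_def inc_edges_insert finite_inc_edges) (simp add: inc_edges_def)

lemma degree_Diff: "finite E \<Longrightarrow> K \<subseteq> E \<Longrightarrow> degree (E - K) v + degree K v = degree E v"
  using degree_Un[of "E - K" K v] finite_subset[of K E] by (simp add: Un_absorb2 Diff_disjoint Int_commute)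

lemma degree_0_iff: "finite E \<Longrightarrow> degree E v = 0 \<longleftrightarrow> v \<notin> \<Union>E"
  by (auto simp: degree_def finite_inc_edges) (auto simp: inc_edges_def)

lemma vsum_outside: "v \<notin> \<Union>E \<Longrightarrow> vsum E f v = 0"
  by (simp add: vsum_def inc_edges_def) (metis (mono_tags, lifting) Collect_empty_eq Union_iff sum.empty)

lemma even_vsum_iff_even_degree:
  assumes "finite E" "\<And>e. e \<in> E \<Longrightarrow> f e = 1 \<or> f e = -1"
  shows "even (vsum E f v) \<longleftrightarrow> even (degree E v)"
proof -
  have "{e \<in> inc_edges E v. odd (f e)} = inc_edges E v"
    using assms(2) by (fastforce simp: inc_edges_def)
  then show ?thesis
    using assms(1) by (simp add: vsum_def degree_def even_sum_iff finite_inc_edges)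
qed

text \<open>Double counting: every edge is seen from its two ends.\<close>

lemma sum_vsum:
  assumes "two_sets E" "finite V" "\<Union>E \<subseteq> V"
  shows "(\<Sum>v\<in>V. vsum E f v) = 2 * sum f E"
proof -
  have fin: "finite E" using assms(1) by (rule two_setsD)
  have "(\<Sum>v\<in>V. vsum E f v) = (\<Sum>v\<in>V. \<Sum>e\<in>E. if v \<in> e then f e else 0)"
    by (simp add: vsum_def inc_edges_def sum.inter_filter fin)
  also have "\<dots> = (\<Sum>e\<in>E. \<Sum>v\<in>V. if v \<in> e then f e else 0)"
    by (rule sum.swap)
  also have "\<dots> = (\<Sum>e\<in>E. 2 * f e)"
  proof (rule sum.cong[OF refl])
    fix e assume e: "e \<in> E"
    have "{v \<in> V. v \<in> e} = e" using e assms(3) by auto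
    then show "(\<Sum>v\<in>V. if v \<in> e then f e else 0) = 2 * f e"
      using two_setsD(2)[OF assms(1) e] assms(2) by (simp add: sum.inter_filter[symmetric])
  qed
  finally show ?thesis by (simp add: sum_distrib_left)
qed

lemma even_card_odd_vertices:
  assumes "two_sets E" "finite V" "\<Union>E \<subseteq> V"
  shows "even (card {v \<in> V. odd (degree E v)})"
proof -
  have "even (\<Sum>v\<in>V. vsum E (\<lambda>_. 1) v)" using sum_vsum[OF assms] by simp
  then show ?thesis using assms(2) by (simp add: even_sum_iff degree_vsum[symmetric])
qed

lemma closed_in_Diff: "closed_in K E \<Longrightarrow> closed_in (E - K) E"
  unfolding closed_in_def by blast

lemma closed_in_disjoint: "closed_in K E \<Longrightarrow> \<Union>K \<inter> \<Union>(E - K) = {}"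
  unfolding closed_in_def by blast

lemma closed_in_trans:
  assumes "closed_in Q K" "closed_in K E" shows "closed_in Q E"
  unfolding closed_in_def
proof (intro conjI ballI impI)
  show "Q \<subseteq> E" using assms by (auto simp: closed_in_def)
  fix e assume e: "e \<in> E" "e \<inter> \<Union>Q \<noteq> {}"
  have "\<Union>Q \<subseteq> \<Union>K" using assms(1) by (simp add: closed_in_def Union_mono)
  then have "e \<inter> \<Union>K \<noteq> {}" using e(2) by fast
  then have "e \<in> K" using assms(2) e(1) by (simp add: closed_in_def)
  then show "e \<in> Q" using assms(1) e(2) by (simp add: closed_in_def)
qed

lemma inc_edges_closed_in: "closed_in K E \<Longrightarrow> v \<in> \<Union>K \<Longrightarrow> inc_edges K v = inc_edges E v"
  unfolding closed_in_def inc_edges_def by blast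

lemma even_graph_closed_in:
  assumes "closed_in K E" "even_graph E" "finite E" shows "even_graph K"
  unfolding even_graph_def
proof
  fix v
  have "finite K" using assms by (auto simp: closed_in_def intro: finite_subset)
  then show "even (degree K v)"
  proof (cases "v \<in> \<Union>K")
    case True
    then show ?thesis using inc_edges_closed_in[OF assms(1) True] assms(2)
      by (simp add: degree_def even_graph_def)
  next
    case False
    then have "degree K v = 0" using degree_0_iff[OF \<open>finite K\<close>] by blast
    then show ?thesis by simp
  qed
qed

section \<open>Trails, closed trails and Euler circuits of a component\<close>

fun trail_edges :: "'a list \<Rightarrow> 'a set list" where
  "trail_edges (x # y # zs) = {x, y} # trail_edges (y # zs)"
| "trail_edges _ = []"

definition trail :: "'a set set \<Rightarrow> 'a list \<Rightarrow> bool" where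
  "trail E xs \<longleftrightarrow> xs \<noteq> [] \<and> distinct (trail_edges xs) \<and> set (trail_edges xs) \<subseteq> E"

lemma trail_edges_join:
  "trail_edges (xs @ y # ys) = trail_edges (xs @ [y]) @ trail_edges (y # ys)"
  by (induction xs rule: trail_edges.induct) auto

lemma length_trail_edges: "length (trail_edges xs) = length xs - 1"
  by (induction xs rule: trail_edges.induct) auto

lemma Union_trail_edges_eq: "length xs \<ge> 2 \<Longrightarrow> \<Union>(set (trail_edges xs)) = set xs"
proof (induction xs rule: trail_edges.induct)
  case (1 x y zs)
  then show ?case by (cases zs) auto
qed auto

lemma trail_length_le:
  assumes "trail E xs" "finite E" shows "length xs \<le> card E + 1"
proof -
  have "length (trail_edges xs) = card (set (trail_edges xs))"
    using assms(1) by (simp add: trail_def distinct_card)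
  also have "\<dots> \<le> card E" using assms by (simp add: trail_def card_mono)
  finally show ?thesis by (simp add: length_trail_edges)
qed

text \<open>Every inner visit to a vertex uses two edges of the trail, so only the two ends matter
  for parity, and they cancel when the trail is closed.\<close>

lemma odd_degree_trail:
  assumes "distinct (trail_edges xs)" "\<And>e. e \<in> set (trail_edges xs) \<Longrightarrow> card e = 2" "xs \<noteq> []"
  shows "odd (degree (set (trail_edges xs)) v) \<longleftrightarrow> (v = hd xs) \<noteq> (v = last xs)"
  using assms
proof (induction xs rule: trail_edges.induct)
  case (1 x y zs)
  have "x \<noteq> y" using "1.prems"(2)[of "{x, y}"] by auto
  then show ?case using 1 by (auto simp: degree_insert)
qed (auto simp: degree_def)

lemma obtain_closed_trail:
  assumes "two_sets E" "even_graph E" "r \<in> \<Union>E"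
  obtains xs where "trail E xs" "hd xs = r" "last xs = r" "length xs \<ge> 2"
proof -
  have fin: "finite E" using assms(1) by (rule two_setsD)
  let ?P = "\<lambda>xs. trail E xs \<and> hd xs = r"
  obtain e where e: "e \<in> E" "r \<in> e" using assms(3) by auto
  obtain z where z: "e = {r, z}" using two_sets_obtain[OF assms(1) e] by metis
  have P0: "?P [r, z]" using e z by (simp add: trail_def)
  have bound: "\<forall>xs. ?P xs \<longrightarrow> length xs < card E + 2"
    using trail_length_le fin by fastforce
  obtain xs where xs: "?P xs" and max: "\<And>ys. ?P ys \<Longrightarrow> length ys \<le> length xs"
    using ex_has_greatest_nat[of ?P "[r, z]" length "card E + 2", OF P0 bound] by blast
  have len: "length xs \<ge> 2" using max[OF P0] by simp
  let ?T = "set (trail_edges xs)"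
  have T: "?T \<subseteq> E" "distinct (trail_edges xs)" "xs \<noteq> []" using xs by (auto simp: trail_def)
  have "last xs = r"
  proof (rule ccontr)
    assume ne: "last xs \<noteq> r"
    have "odd (degree ?T (last xs))"
      using odd_degree_trail[OF T(2) _ T(3)] two_setsD(2)[OF assms(1)] T(1) xs ne by blast
    moreover have "even (degree E (last xs))" using assms(2) by (simp add: even_graph_def)
    ultimately have "degree (E - ?T) (last xs) \<noteq> 0"
      using degree_Diff[OF fin T(1), of "last xs"] by (metis add_0)
    then obtain d where d: "d \<in> E" "d \<notin> ?T" "last xs \<in> d"
      using degree_0_iff[of "E - ?T"] fin by auto
    obtain y where y: "d = {last xs, y}" using two_sets_obtain[OF assms(1) d(1,3)] by metis
    have "trail_edges (xs @ [y]) = trail_edges xs @ [d]"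
      using trail_edges_join[of "butlast xs" "last xs" "[y]"] T(3) y
      by simp (metis append_butlast_last_id append.assoc append_Cons append_Nil)
    then have "?P (xs @ [y])" using xs d by (auto simp: trail_def)
    from max[OF this] show False by simp
  qed
  then show ?thesis using that xs len by blast
qed

text \<open>Take a longest closed trail at \<open>r\<close>. If an edge outside it met it at a
  vertex v, the remaining edges, which again form an even graph, would contain a closed trail at v
  that could be spliced in.\<close>

lemma obtain_euler_circuit:
  assumes "two_sets E" "even_graph E" "r \<in> \<Union>E"
  obtains xs where "trail E xs" "hd xs = r" "last xs = r" "length xs \<ge> 2"
    "closed_in (set (trail_edges xs)) E" "r \<in> \<Union>(set (trail_edges xs))"
proof -
  have fin: "finite E" using assms(1) by (rule two_setsD)
  let ?P = "\<lambda>xs. trail E xs \<and> hd xs = r \<and> last xs = r \<and> length xs \<ge> 2"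
  obtain x0 where P0: "?P x0" using obtain_closed_trail[OF assms] by metis
  have bound: "\<forall>xs. ?P xs \<longrightarrow> length xs < card E + 2"
    using trail_length_le fin by fastforce
  obtain xs where xs: "?P xs" and max: "\<And>ys. ?P ys \<Longrightarrow> length ys \<le> length xs"
    using ex_has_greatest_nat[of ?P x0 length "card E + 2", OF P0 bound] by blast
  let ?T = "set (trail_edges xs)"
  have T: "?T \<subseteq> E" "distinct (trail_edges xs)" "xs \<noteq> []" using xs by (auto simp: trail_def)
  have UT: "\<Union>?T = set xs" using Union_trail_edges_eq xs by blast
  have "closed_in ?T E"
    unfolding closed_in_def
  proof (intro conjI T ballI impI)
    fix e assume e: "e \<in> E" "e \<inter> \<Union>?T \<noteq> {}"
    then obtain v where v: "v \<in> e" "v \<in> set xs" using UT by auto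
    show "e \<in> ?T"
    proof (rule ccontr)
      assume ne: "e \<notin> ?T"
      have "even (degree ?T w)" for w
        using odd_degree_trail[OF T(2) _ T(3), of w] two_setsD(2)[OF assms(1)] T(1) xs by auto
      then have "even_graph (E - ?T)"
        using degree_Diff[OF fin T(1)] assms(2) unfolding even_graph_def by (metis even_add)
      moreover have "two_sets (E - ?T)" using two_sets_subset[OF assms(1)] by blast
      moreover have "v \<in> \<Union>(E - ?T)" using v e ne by auto
      ultimately obtain ys where ys: "trail (E - ?T) ys" "hd ys = v" "last ys = v" "length ys \<ge> 2"
        using obtain_closed_trail by metis
      obtain as bs where ab: "xs = as @ v # bs" using v by (meson split_list)
      obtain cs where cs: "ys = v # cs" using ys by (cases ys) auto
      define ds where "ds = butlast ys"
      have ds: "ys = ds @ [v]" using ys cs by (metis append_butlast_last_id ds_def list.distinct(1))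
      let ?n = "as @ ys @ bs"
      have "trail_edges ?n = trail_edges (as @ [v]) @ trail_edges (ys @ bs)"
        using trail_edges_join[of as v "cs @ bs"] cs by simp
      also have "trail_edges (ys @ bs) = trail_edges ys @ trail_edges (v # bs)"
        using trail_edges_join[of ds v bs] ds by simp
      finally have te: "trail_edges ?n = trail_edges (as @ [v]) @ trail_edges ys @ trail_edges (v # bs)" .
      have tx: "trail_edges xs = trail_edges (as @ [v]) @ trail_edges (v # bs)"
        using trail_edges_join[of as v bs] ab by simp
      have "set (trail_edges ys) \<inter> ?T = {}" "set (trail_edges ys) \<subseteq> E" "distinct (trail_edges ys)"
        using ys(1) by (auto simp: trail_def)
      then have "distinct (trail_edges ?n)" "set (trail_edges ?n) \<subseteq> E"
        using T unfolding te tx by auto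
      moreover have "hd ?n = r" using xs ab cs by (cases as) auto
      moreover have "last ?n = r" using xs ab ds by (cases bs rule: rev_cases) auto
      ultimately have "?P ?n" using ys(4) cs by (auto simp: trail_def)
      from max[OF this] show False using ab ys(4) by simp
    qed
  qed
  moreover have "r \<in> \<Union>?T" using UT xs T(3) by (metis hd_in_set)
  ultimately show ?thesis using that xs by blast
qed

text \<open>
  C consists of the vertices that count as already chosen, and s and t are the signs of the first
  and the last edge. For C = UNIV the signs simply alternate.
\<close>

lemma greedy_signing:
  assumes "length xs \<ge> 2" "distinct (trail_edges xs)"
    "\<And>e. e \<in> set (trail_edges xs) \<Longrightarrow> card e = 2" "last xs \<in> C" "s = 1 \<or> s = (-1::int)"
  shows "\<exists>g C' t. (t = 1 \<or> t = -1) \<and> C \<subseteq> C' \<and> C' \<subseteq> C \<union> set xs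
    \<and> (\<forall>e. g e = 1 \<or> g e = -1)
    \<and> (\<forall>v. vsum (set (trail_edges xs)) g v
          = (if v \<in> C' - C then 2 else 0) + (if v = hd xs then s else 0) + (if v = last xs then t else 0))
    \<and> (\<forall>e\<in>set (trail_edges xs). g e = 1 \<longrightarrow> e \<inter> C' \<noteq> {})"
  using assms
proof (induction xs arbitrary: C s rule: trail_edges.induct)
  case (1 x y zs)
  have xy: "x \<noteq> y" using "1.prems"(3)[of "{x, y}"] by auto
  show ?case
  proof (cases zs)
    \<comment> \<open>No edge follows, so \<open>y\<close> cannot be newly chosen. That the last
      vertex lies in \<open>C\<close> gives a positive last edge its chosen end.\<close>
    case Nil
    show ?thesis
      using xy "1.prems" Nil
      by (intro exI[of _ "\<lambda>_. s"] exI[of _ C] exI[of _ s]) (auto simp: vsum_insert)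
  next
    case (Cons z zs')
    let ?T = "set (trail_edges (y # zs))"
    \<comment> \<open>Repeating the positive sign at the first visit that chooses \<open>y\<close>
      makes the two edges of this visit add 2 to the sum at \<open>y\<close>; at every other visit
      the two signs are opposite and add 0.\<close>
    define C1 where "C1 = (if s = 1 then insert y C else C)"
    define s1 where "s1 = (if s = 1 \<and> y \<notin> C then 1 else - s)"
    have s1: "s1 = 1 \<or> s1 = -1" using "1.prems"(5) by (auto simp: s1_def)
    have l: "last (y # zs) \<in> C1" using "1.prems"(4) Cons by (auto simp: C1_def)
    have "\<exists>g C' t. (t = 1 \<or> t = -1) \<and> C1 \<subseteq> C' \<and> C' \<subseteq> C1 \<union> set (y # zs)
      \<and> (\<forall>e. g e = 1 \<or> g e = -1)
      \<and> (\<forall>v. vsum ?T g v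
            = (if v \<in> C' - C1 then 2 else 0) + (if v = hd (y # zs) then s1 else 0)
              + (if v = last (y # zs) then t else 0))
      \<and> (\<forall>e\<in>?T. g e = 1 \<longrightarrow> e \<inter> C' \<noteq> {})"
    proof (rule "1.IH")
      show "length (y # zs) \<ge> 2" using Cons by simp
      show "distinct (trail_edges (y # zs))" using "1.prems"(2) by simp
      show "card e = 2" if "e \<in> ?T" for e using "1.prems"(3)[of e] that by simp
    qed (fact l s1)+
    then obtain g C' t where IH: "t = 1 \<or> t = -1" "C1 \<subseteq> C'" "C' \<subseteq> C1 \<union> set (y # zs)"
      "\<forall>e. g e = 1 \<or> g e = -1"
      "\<forall>v. vsum ?T g v = (if v \<in> C' - C1 then 2 else 0) + (if v = hd (y # zs) then s1 else 0)
          + (if v = last (y # zs) then t else 0)"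
      "\<forall>e\<in>?T. g e = 1 \<longrightarrow> e \<inter> C' \<noteq> {}"
      by blast
    have nin: "{x, y} \<notin> ?T" using "1.prems"(2) by simp
    let ?g = "g({x, y} := s)"
    have "vsum (set (trail_edges (x # y # zs))) ?g v
        = (if v \<in> C' - C then 2 else 0) + (if v = x then s else 0) + (if v = last (x # y # zs) then t else 0)" for v
    proof -
      have "vsum ?T ?g v = vsum ?T g v" by (rule vsum_cong) (use nin in auto)
      moreover have "vsum (set (trail_edges (x # y # zs))) ?g v
          = (if v \<in> {x, y} then s else 0) + vsum ?T ?g v"
        using nin by (simp add: vsum_insert)
      moreover have "vsum ?T g v = (if v \<in> C' - C1 then 2 else 0) + (if v = y then s1 else 0)
          + (if v = last (y # zs) then t else 0)"
        using IH(5) by simp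
      moreover have "last (y # zs) = last (x # y # zs)" by simp
      moreover have "(if v \<in> {x, y} then s else 0) + (if v \<in> C' - C1 then 2 else 0) + (if v = y then s1 else 0)
          = (if v \<in> C' - C then 2 else 0) + (if v = x then s else 0)"
      proof (cases "s = 1 \<and> y \<notin> C")
        case True
        then show ?thesis using IH(2) xy by (auto simp: C1_def s1_def)
      next
        case False
        then have "C1 = C" "s1 = - s" using "1.prems"(5) by (auto simp: C1_def s1_def)
        then show ?thesis using xy by auto
      qed
      ultimately show ?thesis by (metis (no_types, lifting) add.assoc)
    qed
    then have vs: "\<forall>v. vsum (set (trail_edges (x # y # zs))) ?g v
        = (if v \<in> C' - C then 2 else 0) + (if v = hd (x # y # zs) then s else 0) + (if v = last (x # y # zs) then t else 0)"
      by simp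
    have pos: "\<forall>e\<in>set (trail_edges (x # y # zs)). ?g e = 1 \<longrightarrow> e \<inter> C' \<noteq> {}"
      using IH(2,6) nin "1.prems"(5) by (auto simp: C1_def)
    have sub: "C \<subseteq> C'" "C' \<subseteq> C \<union> set (x # y # zs)"
      using IH(2,3) by (auto simp: C1_def split: if_splits)
    have "\<forall>e. ?g e = 1 \<or> ?g e = -1" using IH(4) "1.prems"(5) by simp
    then show ?thesis using IH(1) sub vs pos by blast
  qed
qed auto

section \<open>Signings and the augmented graph\<close>

definition signing :: "'a set set \<Rightarrow> ('a set \<Rightarrow> int) \<Rightarrow> bool" where
  "signing E f \<longleftrightarrow> (\<forall>e\<in>E. f e = 1 \<or> f e = -1)"

definition edge_dominating :: "'a set set \<Rightarrow> ('a set \<Rightarrow> int) \<Rightarrow> bool" where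
  "edge_dominating E f \<longleftrightarrow> (\<forall>u v. {u, v} \<in> E \<longrightarrow> f {u, v} < vsum E f u + vsum E f v)"

lemma signingD: "signing E f \<Longrightarrow> e \<in> E \<Longrightarrow> f e = 1 \<or> f e = -1"
  by (simp add: signing_def)

lemma even_vsum_iff:
  "finite E \<Longrightarrow> signing E f \<Longrightarrow> even (vsum E f v) \<longleftrightarrow> even (degree E v)"
  using even_vsum_iff_even_degree signingD by metis

text \<open>An edge uv is the only edge at both of its ends, so S(u) + S(v) counts it twice and the
  sum over its closed neighbourhood is S(u) + S(v) - f(uv).\<close>

lemma is_SEDF_if_edge_dominating:
  assumes "two_sets E" "signing E f" "edge_dominating E f"
  shows "is_SEDF E f"
proof -
  have "sum f (closed_edge_nbhd E e) \<ge> 1" if e: "e \<in> E" for e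
  proof -
    obtain u v where uv: "e = {u, v}" "u \<noteq> v"
      using two_setsD(2)[OF assms(1) e] by (auto simp: card_2_iff)
    have fin: "finite (inc_edges E u)" "finite (inc_edges E v)"
      using two_setsD(1)[OF assms(1)] by (simp_all add: finite_inc_edges)
    have "inc_edges E u \<inter> inc_edges E v = {e}"
    proof -
      have "d = e" if "d \<in> E" "u \<in> d" "v \<in> d" for d
      proof -
        have c: "card d = 2" using two_setsD(2)[OF assms(1) that(1)] .
        then have "finite d" using card.infinite by fastforce
        moreover have "{u, v} \<subseteq> d" "card {u, v} = card d" using that uv(2) c by simp_all
        ultimately show ?thesis unfolding uv(1) using card_subset_eq[of d "{u, v}"] by metis
      qed
      then have "inc_edges E u \<inter> inc_edges E v \<subseteq> {e}" unfolding inc_edges_def by blast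
      moreover have "e \<in> inc_edges E u \<inter> inc_edges E v" using e uv by (simp add: inc_edges_def)
      ultimately show ?thesis by blast
    qed
    then have "sum f (closed_edge_nbhd E e) = vsum E f u + vsum E f v - f e"
      using sum_Un[OF fin, of f] uv by (simp add: closed_edge_nbhd_def vsum_def)
    moreover have "f e < vsum E f u + vsum E f v"
      using assms(3) e unfolding uv(1) edge_dominating_def by simp
    ultimately show ?thesis by linarith
  qed
  then show ?thesis using assms(2) by (simp add: is_SEDF_def signing_def)
qed

text \<open>There may be infinitely many SEDFs as functions on the whole type, so the finiteness
  that \<open>Min\<close> requires is taken from the values: every sum lies between -|E| and
  |E|.\<close>

lemma signed_edge_dom_num_le:
  assumes "finite E" "is_SEDF E f" shows "signed_edge_dom_num E \<le> sum f E"
  unfolding signed_edge_dom_num_def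
proof (rule Min_le)
  have "sum g E \<in> {- int (card E)..int (card E)}" if "is_SEDF E g" for g
  proof -
    have "g e \<le> 1 \<and> -1 \<le> g e" if "e \<in> E" for e
    proof -
      have "g e = 1 \<or> g e = -1" using \<open>is_SEDF E g\<close> that unfolding is_SEDF_def by simp
      then show ?thesis by auto
    qed
    then show ?thesis
      using sum_bounded_above[of E g 1] sum_bounded_below[of E "-1" g] by simp
  qed
  then have "{sum g E |g. is_SEDF E g} \<subseteq> {- int (card E)..int (card E)}" by blast
  then show "finite {sum g E |g. is_SEDF E g}" by (rule finite_subset) simp
  show "sum f E \<in> {sum g E |g. is_SEDF E g}" using assms(2) by blast
qed

section \<open>Turning negative edges positive, and alternating signings\<close>

definition raise_on :: "'a set set \<Rightarrow> ('a set \<Rightarrow> int) \<Rightarrow> 'a set \<Rightarrow> int" where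
  "raise_on D f e = (if e \<in> D then 1 else f e)"

lemma sum_raise_on:
  assumes "finite E" "D \<subseteq> {e \<in> E. f e = -1}"
  shows "sum (raise_on D f) E = sum f E + 2 * int (card D)"
proof -
  have "sum (raise_on D f) E = (\<Sum>e\<in>E. f e + (if e \<in> D then 2 else 0))"
    using assms(2) by (intro sum.cong) (auto simp: raise_on_def)
  also have "\<dots> = sum f E + sum (\<lambda>_. 2) {e \<in> E. e \<in> D}"
    using sum.inter_filter[OF assms(1), of "\<lambda>_. 2::int" "\<lambda>e. e \<in> D"] by (simp add: sum.distrib)
  also have "{e \<in> E. e \<in> D} = D" using assms(2) by auto
  finally show ?thesis by simp
qed

lemma vsum_raise_on:
  assumes "finite E" "D \<subseteq> {e \<in> E. f e = -1}"
  shows "vsum E (raise_on D f) v = vsum E f v + 2 * int (card {e \<in> D. v \<in> e})"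
proof -
  have "vsum E (raise_on D f) v = sum (raise_on {e \<in> D. v \<in> e} f) (inc_edges E v)"
    unfolding vsum_def by (rule sum.cong) (auto simp: raise_on_def inc_edges_def)
  also have "\<dots> = vsum E f v + 2 * int (card {e \<in> D. v \<in> e})"
    unfolding vsum_def
    by (rule sum_raise_on) (use assms in \<open>auto simp: finite_inc_edges, auto simp: inc_edges_def\<close>)
  finally show ?thesis .
qed

lemma signing_raise_on: "signing E f \<Longrightarrow> signing E (raise_on D f)"
  by (simp add: signing_def raise_on_def)

lemma vsum_raise_on_ge:
  assumes "finite E" "D \<subseteq> {e \<in> E. f e = -1}"
  shows "vsum E f v \<le> vsum E (raise_on D f) v"
    and "e \<in> D \<Longrightarrow> v \<in> e \<Longrightarrow> vsum E f v + 2 \<le> vsum E (raise_on D f) v"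
proof -
  show "vsum E f v \<le> vsum E (raise_on D f) v" by (simp add: vsum_raise_on[OF assms])
  assume e: "e \<in> D" "v \<in> e"
  have "finite D" using assms finite_subset by fastforce
  then have "card {e \<in> D. v \<in> e} \<noteq> 0" using e by auto
  then show "vsum E f v + 2 \<le> vsum E (raise_on D f) v" by (simp add: vsum_raise_on[OF assms])
qed

lemma obtain_negative_edge:
  assumes "signing E f" "vsum E f v < int (degree E v)"
  obtains e where "e \<in> E" "v \<in> e" "f e = -1"
proof -
  have "\<exists>e\<in>inc_edges E v. f e \<noteq> 1"
  proof (rule ccontr)
    assume "\<not> ?thesis"
    then have "vsum E f v = int (degree E v)" by (simp add: vsum_def degree_def)
    then show False using assms(2) by simp
  qed
  then show ?thesis using that assms(1) by (auto simp: inc_edges_def signing_def)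
qed

text \<open>Each component gets an Euler circuit that starts at \<open>w\<close> if possible and
  otherwise at a root from \<open>A\<close>. With alternating signs only the starting vertex can
  have a nonzero sum, and it does not occur in the other components.\<close>

lemma alternating_signing:
  assumes "two_sets H" "even_graph H"
    "\<And>Q. closed_in Q H \<Longrightarrow> Q \<noteq> {} \<Longrightarrow> w \<notin> \<Union>Q \<Longrightarrow> \<exists>v\<in>A. v \<in> \<Union>Q"
  shows "\<exists>g. (\<forall>e. g e = 1 \<or> g e = -1) \<and> (vsum H g w = 0 \<or> vsum H g w = -2)
    \<and> (\<forall>v. v \<noteq> w \<longrightarrow> vsum H g v = 0 \<or> v \<in> A \<and> vsum H g v = 2)"
  using assms
proof (induction "card H" arbitrary: H rule: less_induct)
  case less
  have fin: "finite H" using less.prems(1) by (rule two_setsD)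
  show ?case
  proof (cases "H = {}")
    case True
    then show ?thesis by (intro exI[of _ "\<lambda>_. 1"]) simp
  next
    case False
    have "closed_in H H" by (auto simp: closed_in_def)
    then obtain r where r: "r \<in> \<Union>H" "r = w \<or> w \<notin> \<Union>H \<and> r \<in> A"
      using less.prems(3)[of H] False by (cases "w \<in> \<Union>H") auto
    obtain xs where xs: "trail H xs" "hd xs = r" "last xs = r" "length xs \<ge> 2"
      "closed_in (set (trail_edges xs)) H" "r \<in> \<Union>(set (trail_edges xs))"
      using obtain_euler_circuit[OF less.prems(1,2) r(1)] by metis
    let ?T = "set (trail_edges xs)"
    have T: "?T \<subseteq> H" "distinct (trail_edges xs)" using xs(1) by (auto simp: trail_def)
    \<comment> \<open>The sign t of the last edge is unknown, so the first sign decides the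
      direction of the defect: s + t is -2 or 0 at \<open>w\<close>, and 0 or 2 at a root.\<close>
    define s :: int where "s = (if r = w then -1 else 1)"
    have "\<exists>g C' t. (t = 1 \<or> t = -1) \<and> UNIV \<subseteq> C' \<and> C' \<subseteq> UNIV \<union> set xs
      \<and> (\<forall>e. g e = 1 \<or> g e = -1)
      \<and> (\<forall>v. vsum ?T g v = (if v \<in> C' - UNIV then 2 else 0) + (if v = hd xs then s else 0)
            + (if v = last xs then t else 0))
      \<and> (\<forall>e\<in>?T. g e = 1 \<longrightarrow> e \<inter> C' \<noteq> {})"
      using xs(4) T two_setsD(2)[OF less.prems(1)]
      by (intro greedy_signing) (auto simp: s_def)
    then obtain g1 C' t where g1: "t = 1 \<or> t = -1" "\<forall>e. g1 e = 1 \<or> g1 e = -1"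
      "UNIV \<subseteq> C'"
      "\<forall>v. vsum ?T g1 v = (if v \<in> C' - UNIV then 2 else 0) + (if v = hd xs then s else 0)
            + (if v = last xs then t else 0)"
      by blast
    have v1: "vsum ?T g1 v = (if v = r then s + t else 0)" for v
      using g1(4) xs(2,3) by simp
    have cl: "closed_in (H - ?T) H" using xs(5) by (rule closed_in_Diff)
    have disj: "\<Union>?T \<inter> \<Union>(H - ?T) = {}" using xs(5) by (rule closed_in_disjoint)
    obtain e where "e \<in> ?T" using xs(6) by blast
    then have "H - ?T \<subset> H" using T(1) by (intro psubsetI) auto
    then have "card (H - ?T) < card H" using fin by (rule psubset_card_mono[rotated])
    moreover have "two_sets (H - ?T)" using two_sets_subset[OF less.prems(1)] by blast
    moreover have "even_graph (H - ?T)" using even_graph_closed_in[OF cl less.prems(2) fin] .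
    moreover have "\<exists>v\<in>A. v \<in> \<Union>Q" if "closed_in Q (H - ?T)" "Q \<noteq> {}" "w \<notin> \<Union>Q" for Q
      using less.prems(3)[OF closed_in_trans[OF that(1) cl] that(2,3)] .
    ultimately have "\<exists>g. (\<forall>e. g e = 1 \<or> g e = -1) \<and> (vsum (H - ?T) g w = 0 \<or> vsum (H - ?T) g w = -2)
      \<and> (\<forall>v. v \<noteq> w \<longrightarrow> vsum (H - ?T) g v = 0 \<or> v \<in> A \<and> vsum (H - ?T) g v = 2)"
      by (rule less.hyps)
    then obtain g2 where g2: "\<forall>e. g2 e = 1 \<or> g2 e = -1"
      "vsum (H - ?T) g2 w = 0 \<or> vsum (H - ?T) g2 w = -2"
      "\<And>v. v \<noteq> w \<Longrightarrow> vsum (H - ?T) g2 v = 0 \<or> v \<in> A \<and> vsum (H - ?T) g2 v = 2"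
      by blast
    define g where "g = (\<lambda>e. if e \<in> ?T then g1 e else g2 e)"
    have vs: "vsum H g v = vsum ?T g1 v + vsum (H - ?T) g2 v" for v
    proof -
      have "vsum H g v = vsum ?T g v + vsum (H - ?T) g v"
        using vsum_Un[of ?T "H - ?T" g v] T(1) fin by (simp add: Un_absorb1)
      moreover have "vsum ?T g v = vsum ?T g1 v" "vsum (H - ?T) g v = vsum (H - ?T) g2 v"
        by (rule vsum_cong; simp add: g_def)+
      ultimately show ?thesis by simp
    qed
    have r0: "vsum (H - ?T) g2 r = 0"
      by (rule vsum_outside) (use disj xs(6) in blast)
    have "\<forall>e. g e = 1 \<or> g e = -1" using g1(2) g2(1) by (simp add: g_def)
    moreover have "vsum H g w = 0 \<or> vsum H g w = -2"
      using vs[of w] v1[of w] g1(1) g2(2) r0 r(2) by (auto simp: s_def)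
    moreover have "vsum H g v = 0 \<or> v \<in> A \<and> vsum H g v = 2" if "v \<noteq> w" for v
      using vs[of v] v1[of v] g1(1) g2(3)[OF that] r0 r(2) that by (auto simp: s_def)
    ultimately show ?thesis by blast
  qed
qed

section \<open>The graph with a new vertex \<open>None\<close> joined to a set
  \<open>W\<close>\<close>

definition augment :: "'a set set \<Rightarrow> 'a set \<Rightarrow> 'a option set set" where
  "augment E W = image Some ` E \<union> (\<lambda>v. {None, Some v}) ` W"

abbreviation odd_verts :: "'a set \<Rightarrow> 'a set set \<Rightarrow> 'a set" where
  "odd_verts V E \<equiv> {v \<in> V. odd (degree E v)}"

lemma two_sets_augment: "two_sets E \<Longrightarrow> finite W \<Longrightarrow> two_sets (augment E W)"
  by (auto simp: two_sets_def augment_def card_image)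

lemma inc_edges_augment_Some:
  "inc_edges (augment E W) (Some v)
    = image Some ` inc_edges E v \<union> (if v \<in> W then {{None, Some v}} else {})"
  by (auto simp: inc_edges_def augment_def)

lemma inc_edges_augment_None: "inc_edges (augment E W) None = (\<lambda>v. {None, Some v}) ` W"
  by (auto simp: inc_edges_def augment_def)

lemma inj_image_Some: "inj_on (image Some) X"
  by (rule inj_onI) (metis inj_Some inj_image_eq_iff)

lemma vsum_augment_Some:
  assumes "finite E"
  shows "vsum (augment E W) g (Some v)
    = vsum E (\<lambda>e. g (Some ` e)) v + (if v \<in> W then g {None, Some v} else 0)"
proof -
  have "{None, Some v} \<notin> image Some ` inc_edges E v" by auto
  then show ?thesis
    using finite_inc_edges[OF assms, of v]
    by (simp add: vsum_def inc_edges_augment_Some sum.reindex[OF inj_image_Some] add.commute)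
qed

lemma vsum_augment_None: "vsum (augment E W) g None = (\<Sum>v\<in>W. g {None, Some v})"
proof -
  have "inj_on (\<lambda>v. {None, Some v}) W" by (rule inj_onI) (auto simp: doubleton_eq_iff)
  then show ?thesis by (simp add: vsum_def inc_edges_augment_None sum.reindex)
qed

lemma simple_graphD:
  assumes "simple_graph V E"
  shows "finite V" "two_sets E" "\<Union>E \<subseteq> V"
proof -
  show "finite V" "\<Union>E \<subseteq> V" using assms by (auto simp: simple_graph_def)
  then have "finite E" by (metis finite_UnionD finite_subset)
  then show "two_sets E" using assms by (auto simp: simple_graph_def two_sets_def)
qed

text \<open>At \<open>None\<close> this is the handshake lemma: the number of odd vertices is
  even.\<close>

lemma even_graph_augment:
  assumes "simple_graph V E" shows "even_graph (augment E (odd_verts V E))"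
  unfolding even_graph_def
proof
  note G = simple_graphD[OF assms]
  have fin: "finite E" using G(2) by (rule two_setsD)
  fix x show "even (degree (augment E (odd_verts V E)) x)"
  proof (cases x)
    case None
    have "int (degree (augment E (odd_verts V E)) None) = int (card (odd_verts V E))"
      by (simp add: degree_vsum vsum_augment_None)
    then show ?thesis using even_card_odd_vertices[OF G(2,1,3)] None by simp
  next
    case (Some v)
    have d: "int (degree (augment E (odd_verts V E)) (Some v))
        = int (degree E v) + (if v \<in> odd_verts V E then 1 else 0)"
      by (simp add: degree_vsum vsum_augment_Some[OF fin])
    have "v \<in> V" if "odd (degree E v)"
      using that degree_0_iff[OF fin, of v] G(3) by (metis even_zero subsetD)
    then have "even (int (degree (augment E (odd_verts V E)) (Some v)))" unfolding d by auto
    then show ?thesis using Some by simp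
  qed
qed

text \<open>The edges of \<open>D\<close> are signed in advance by \<open>h\<close>. As
  \<open>h\<close> has sum 0 everywhere, \<open>D\<close> has even degrees, so the rest of
  \<open>H\<close> is still even, and signing it alternately gives the final sums in
  \<open>H\<close>. Removing \<open>D\<close> may create new components; therefore
  \<open>roots\<close> speaks of \<open>H - D\<close>.\<close>

lemma obtain_balanced_signing:
  assumes G: "simple_graph V E"
    and H: "H = augment E (odd_verts V E)"
    and D: "D \<subseteq> H" "signing D h" "\<And>v. vsum D h v = 0"
    and roots: "\<And>Q. closed_in Q (H - D) \<Longrightarrow> Q \<noteq> {} \<Longrightarrow> None \<notin> \<Union>Q \<Longrightarrow> \<exists>v\<in>A. Some v \<in> \<Union>Q"
    and A: "\<And>v. v \<in> A \<Longrightarrow> v \<in> V \<and> even (degree E v)"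
  obtains f where "signing E f" "\<And>e. e \<in> E \<Longrightarrow> Some ` e \<in> D \<Longrightarrow> f e = h (Some ` e)"
    "\<And>v. v \<in> V \<Longrightarrow> odd (degree E v) \<Longrightarrow> vsum E f v = 1 \<or> vsum E f v = -1"
    "\<And>v. v \<in> V \<Longrightarrow> odd (degree E v) \<Longrightarrow> {None, Some v} \<in> D \<Longrightarrow> vsum E f v = - h {None, Some v}"
    "\<And>v. v \<in> V \<Longrightarrow> even (degree E v) \<Longrightarrow> vsum E f v = 0 \<or> v \<in> A \<and> vsum E f v = 2"
    "2 * card {v \<in> V. vsum E f v = -1} \<le> v_odd V E"
proof -
  note G' = simple_graphD[OF G]
  let ?W = "odd_verts V E"
  have fin: "finite E" using G'(2) by (rule two_setsD)
  have finW: "finite ?W" using G'(1) by simp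
  have tH: "two_sets H" unfolding H using two_sets_augment[OF G'(2) finW] .
  have finH: "finite H" using tH by (rule two_setsD)
  have finD: "finite D" using D(1) finH finite_subset by blast
  have evD: "even (degree D v)" for v
    using even_vsum_iff[OF finD D(2), of v] D(3) by simp
  have "even_graph (H - D)"
    using even_graph_augment[OF G] degree_Diff[OF finH D(1)] evD
    unfolding H[symmetric] even_graph_def by (metis even_add)
  moreover have "two_sets (H - D)" using two_sets_subset[OF tH] by blast
  moreover have "\<exists>v\<in>Some ` A. v \<in> \<Union>Q" if "closed_in Q (H - D)" "Q \<noteq> {}" "None \<notin> \<Union>Q" for Q
    using roots[OF that] by blast
  ultimately have "\<exists>g. (\<forall>e. g e = 1 \<or> g e = -1) \<and> (vsum (H - D) g None = 0 \<or> vsum (H - D) g None = -2)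
    \<and> (\<forall>v. v \<noteq> None \<longrightarrow> vsum (H - D) g v = 0 \<or> v \<in> Some ` A \<and> vsum (H - D) g v = 2)"
    using alternating_signing[of "H - D" None "Some ` A"] by fast
  then obtain g where g: "\<forall>e. g e = 1 \<or> g e = -1"
    "vsum (H - D) g None = 0 \<or> vsum (H - D) g None = -2"
    "\<And>v. v \<noteq> None \<Longrightarrow> vsum (H - D) g v = 0 \<or> v \<in> Some ` A \<and> vsum (H - D) g v = 2"
    by blast
  define k where "k = (\<lambda>e. if e \<in> D then h e else g e)"
  have k: "k e = 1 \<or> k e = -1" for e using g(1) D(2) by (auto simp: k_def signing_def)
  have vk: "vsum H k v = vsum (H - D) g v" for v
  proof -
    have "vsum H k v = vsum D k v + vsum (H - D) k v"
      using vsum_Un[of D "H - D" k v] D(1) finD finH by (simp add: Un_absorb1)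
    moreover have "vsum D k v = vsum D h v" "vsum (H - D) k v = vsum (H - D) g v"
      by (rule vsum_cong; simp add: k_def)+
    ultimately show ?thesis using D(3) by simp
  qed
  define f where "f = (\<lambda>e. k (Some ` e))"
  have S: "vsum E f v = vsum H k (Some v) - (if v \<in> ?W then k {None, Some v} else 0)" for v
    using vsum_augment_Some[OF fin, of ?W k v] by (simp add: H f_def)
  \<comment> \<open>Only even vertices lie in \<open>A\<close>, so an odd vertex has sum 0 in
    \<open>H\<close>, and deleting its edge to \<open>None\<close> leaves minus the sign of that
    edge.\<close>
  have o: "vsum E f v = - k {None, Some v}" if "v \<in> ?W" for v
    using S[of v] that vk g(3)[of "Some v"] A by auto
  have ev: "vsum E f v = 0 \<or> v \<in> A \<and> vsum E f v = 2" if "v \<in> V" "even (degree E v)" for v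
    using S[of v] that vk g(3)[of "Some v"] by auto
  have P: "{v \<in> V. vsum E f v = -1} = {v \<in> ?W. k {None, Some v} = 1}" (is "?P = _")
    using o ev by fastforce
  \<comment> \<open>The sum at \<open>None\<close> is at most 0, so at most half of its edges are
    positive; these are the edges to the vertices of sum -1.\<close>
  have "(\<Sum>v\<in>?W. k {None, Some v}) = (\<Sum>v\<in>?W. 2 * (if k {None, Some v} = 1 then 1 else 0) - 1)"
    by (rule sum.cong) (use k in fastforce)+
  also have "\<dots> = 2 * int (card ?P) - int (card ?W)"
    using finW unfolding P by (simp add: sum_subtractf sum_distrib_left[symmetric] sum.inter_filter[symmetric])
  finally have "2 * int (card ?P) - int (card ?W) \<le> 0"
    using g(2) vk[of None] vsum_augment_None[of E ?W k] by (auto simp: H)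
  then have "2 * card ?P \<le> v_odd V E" by (simp add: v_odd_def)
  moreover have "signing E f" using k by (simp add: signing_def f_def)
  moreover have "f e = h (Some ` e)" if "Some ` e \<in> D" for e using that by (simp add: f_def k_def)
  moreover have "vsum E f v = 1 \<or> vsum E f v = -1" if "v \<in> V" "odd (degree E v)" for v
    using o[of v] that k[of "{None, Some v}"] by auto
  moreover have "vsum E f v = - h {None, Some v}" if "v \<in> V" "odd (degree E v)" "{None, Some v} \<in> D" for v
    using o[of v] that by (simp add: k_def)
  ultimately show ?thesis using that ev by blast
qed

section \<open>The bound with the even vertices\<close>

definition balanced :: "'a set \<Rightarrow> 'a set set \<Rightarrow> ('a set \<Rightarrow> int) \<Rightarrow> bool" where
  "balanced V E f \<longleftrightarrow> signing E f
    \<and> (\<forall>v\<in>V. odd (degree E v) \<longrightarrow> vsum E f v = 1 \<or> vsum E f v = -1)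
    \<and> (\<forall>v\<in>V. even (degree E v) \<longrightarrow> vsum E f v = 0 \<or> vsum E f v = 2)
    \<and> 2 * card {v \<in> V. vsum E f v = -1} \<le> v_odd V E"

text \<open>Isolated vertices are left out: they lie on no edge, so their sum 0 violates
  nothing.\<close>

definition deficient :: "'a set \<Rightarrow> 'a set set \<Rightarrow> ('a set \<Rightarrow> int) \<Rightarrow> 'a set" where
  "deficient V E f = {v \<in> V. vsum E f v = -1 \<or> vsum E f v = 0 \<and> degree E v \<noteq> 0}"

lemma int_card_filter: "finite V \<Longrightarrow> int (card {v \<in> V. P v}) = (\<Sum>v\<in>V. if P v then 1 else 0)"
  by (simp add: sum.inter_filter[symmetric])

lemma card_odd_even:
  assumes "finite V" shows "v_odd V E + v_even V E = card V"
proof -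
  have "card V = card ({v \<in> V. odd (degree E v)} \<union> {v \<in> V. even (degree E v)})"
    by (rule arg_cong[of _ _ card]) blast
  also have "\<dots> = v_odd V E + v_even V E"
    unfolding v_odd_def v_even_def by (rule card_Un_disjoint) (use assms in auto)
  finally show ?thesis by simp
qed

text \<open>The left side is the cost of repairing every deficient vertex separately, together with
  the savings against the budget of 2 per even vertex: a root of sum 2 costs only 1, an isolated
  vertex costs 0.\<close>

lemma balanced_sum:
  assumes G: "simple_graph V E" and f: "balanced V E f"
  shows "sum f E + 2 * int (card (deficient V E f)) + int (card {v \<in> V. vsum E f v = 2})
    + 2 * int (card {v \<in> V. degree E v = 0}) \<le> int (card V) + int (v_even V E)"
proof -
  note G' = simple_graphD[OF G]
  \<comment> \<open>All weights are twice those of the claim, since the vertex sums add up to twice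
    \<open>sum f E\<close>. At each single vertex this is an identity; the inequality enters only
    through the number of vertices of sum -1.\<close>
  have p: "vsum E f v + 4 * (if vsum E f v = -1 \<or> vsum E f v = 0 \<and> degree E v \<noteq> 0 then 1 else 0)
        + 2 * (if vsum E f v = 2 then 1 else 0) + 4 * (if degree E v = 0 then 1 else 0)
      = (if odd (degree E v) then 1 else 0) + 2 * (if vsum E f v = -1 then 1 else 0)
        + 4 * (if even (degree E v) then 1 else 0)" if "v \<in> V" for v
  proof (cases "degree E v = 0")
    case True
    then have "vsum E f v = 0"
      using degree_0_iff[OF two_setsD(1)[OF G'(2)]] vsum_outside by metis
    then show ?thesis using True by simp
  next
    case False
    then show ?thesis using f that unfolding balanced_def by auto
  qed
  have "(\<Sum>v\<in>V. vsum E f v) + 4 * int (card (deficient V E f)) + 2 * int (card {v \<in> V. vsum E f v = 2})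
        + 4 * int (card {v \<in> V. degree E v = 0})
      = (\<Sum>v\<in>V. vsum E f v + 4 * (if vsum E f v = -1 \<or> vsum E f v = 0 \<and> degree E v \<noteq> 0 then 1 else 0)
        + 2 * (if vsum E f v = 2 then 1 else 0) + 4 * (if degree E v = 0 then 1 else 0))"
    unfolding deficient_def int_card_filter[OF G'(1)] by (simp only: sum.distrib sum_distrib_left)
  also have "\<dots> = (\<Sum>v\<in>V. (if odd (degree E v) then 1 else 0) + 2 * (if vsum E f v = -1 then 1 else 0)
        + 4 * (if even (degree E v) then 1 else 0))"
    by (rule sum.cong[OF refl]) (rule p)
  also have "\<dots> = int (v_odd V E) + 2 * int (card {v \<in> V. vsum E f v = -1}) + 4 * int (v_even V E)"
    unfolding v_odd_def v_even_def int_card_filter[OF G'(1)] by (simp only: sum.distrib sum_distrib_left)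
  finally have "2 * sum f E + 4 * int (card (deficient V E f)) + 2 * int (card {v \<in> V. vsum E f v = 2})
        + 4 * int (card {v \<in> V. degree E v = 0})
      = int (v_odd V E) + 2 * int (card {v \<in> V. vsum E f v = -1}) + 4 * int (v_even V E)"
    using sum_vsum[OF G'(2,1,3), of f] by simp
  moreover have "2 * card {v \<in> V. vsum E f v = -1} \<le> v_odd V E" using f by (simp add: balanced_def)
  moreover have "v_odd V E + v_even V E = card V" using card_odd_even[OF G'(1)] .
  ultimately show ?thesis by linarith
qed

section \<open>Repairing deficient vertices by a cover of negative edges\<close>

lemma ex_negative_cover:
  assumes "signing E f" "finite M" "\<And>v. v \<in> M \<Longrightarrow> vsum E f v < int (degree E v)"
  shows "\<exists>D \<subseteq> {e \<in> E. f e = -1}. card D \<le> card M \<and> (\<forall>v\<in>M. \<exists>d\<in>D. v \<in> d)"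
proof -
  have "\<forall>v\<in>M. \<exists>e. e \<in> E \<and> v \<in> e \<and> f e = -1"
    using obtain_negative_edge[OF assms(1)] assms(3) by metis
  then obtain c where "\<forall>v\<in>M. c v \<in> E \<and> v \<in> c v \<and> f (c v) = -1" by metis
  then show ?thesis
    using card_image_le[OF assms(2), of c] by (intro exI[of _ "c ` M"]) auto
qed

lemma deficient_less_degree: "v \<in> deficient V E f \<Longrightarrow> vsum E f v < int (degree E v)"
  by (auto simp: deficient_def)

text \<open>The even vertices in X may stay at sum 0, since their positive edges lead to even vertices of sum 2.\<close>

lemma edge_dominating_raise_on:
  assumes G: "simple_graph V E" and f: "balanced V E f"
    and D: "D \<subseteq> {e \<in> E. f e = -1}" "\<And>v. v \<in> deficient V E f - X \<Longrightarrow> \<exists>d\<in>D. v \<in> d"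
    and X: "\<And>x. x \<in> X \<Longrightarrow> even (degree E x)"
      "\<And>x y. x \<in> X \<Longrightarrow> {x, y} \<in> E \<Longrightarrow> f {x, y} = 1 \<Longrightarrow> even (degree E y) \<and> y \<notin> X"
  shows "edge_dominating E (raise_on D f)"
  unfolding edge_dominating_def
proof (intro allI impI)
  note G' = simple_graphD[OF G]
  have fin: "finite E" using G'(2) by (rule two_setsD)
  let ?S = "vsum E (raise_on D f)"
  note ge = vsum_raise_on_ge[OF fin D(1)]
  fix u v assume uv: "{u, v} \<in> E"
  then have V: "u \<in> V" "v \<in> V" "degree E u \<noteq> 0" "degree E v \<noteq> 0"
    using G'(3) degree_0_iff[OF fin] by auto
  have o: "?S w \<ge> 1" if "w \<in> V" "odd (degree E w)" for w
  proof (cases "vsum E f w = -1")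
    case True
    then have "\<exists>d\<in>D. w \<in> d" using that X(1) by (intro D(2)) (auto simp: deficient_def)
    then show ?thesis using ge(2)[of _ w] True by fastforce
  next
    case False
    then show ?thesis using f that ge(1)[of w] by (auto simp: balanced_def)
  qed
  have e0: "?S w \<ge> 0" if "w \<in> V" "even (degree E w)" for w
    using f that ge(1)[of w] by (auto simp: balanced_def)
  have e2: "?S w \<ge> 2" if "w \<in> V" "even (degree E w)" "degree E w \<noteq> 0" "w \<notin> X" for w
  proof (cases "vsum E f w = 0")
    case True
    then have "\<exists>d\<in>D. w \<in> d" using that by (intro D(2)) (auto simp: deficient_def)
    then show ?thesis using ge(2)[of _ w] True by fastforce
  next
    case False
    then have "vsum E f w = 2" using f that by (auto simp: balanced_def)
    then show ?thesis using ge(1)[of w] by simp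
  qed
  have nn: "?S w \<ge> 0" if "w \<in> V" for w using o[OF that] e0[OF that] by fastforce
  have ge1: "?S w \<ge> 1" if "w \<in> V" "degree E w \<noteq> 0" "w \<notin> X" for w
    using o[OF that(1)] e2[OF that(1) _ that(2,3)] by fastforce
  have pos: "?S u + ?S v \<ge> 2" if r: "raise_on D f {u, v} = 1"
  proof (cases "{u, v} \<in> D")
    case True
    \<comment> \<open>Both ends of a raised edge start from at least -1 and gain at least 2, so
      together they reach 2.\<close>
    have "vsum E f w \<ge> -1" if "w \<in> V" for w
      using f that by (cases "even (degree E w)") (auto simp: balanced_def)
    then have "vsum E f u \<ge> -1" "vsum E f v \<ge> -1" using V by blast+
    then show ?thesis using ge(2)[OF True, of u] ge(2)[OF True, of v] by simp
  next
    case False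
    then have fe: "f {u, v} = 1" using r by (simp add: raise_on_def)
    consider "u \<in> X" | "v \<in> X" | "u \<notin> X" "v \<notin> X" by blast
    then show ?thesis
    proof cases
      case 1
      then have "even (degree E v)" "v \<notin> X" using X(2) uv fe by blast+
      then show ?thesis using e2[of v] nn[of u] V by simp
    next
      case 2
      have "{v, u} \<in> E" "f {v, u} = 1" using uv fe by (simp_all add: insert_commute)
      then have "even (degree E u)" "u \<notin> X" using X(2) 2 by blast+
      then show ?thesis using e2[of u] nn[of v] V by simp
    next
      case 3
      then show ?thesis using ge1[of u] ge1[of v] V by simp
    qed
  qed
  have "signing E (raise_on D f)" using f by (auto simp: balanced_def intro: signing_raise_on)
  then have "raise_on D f {u, v} = 1 \<or> raise_on D f {u, v} = -1" using uv by (rule signingD)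
  then show "raise_on D f {u, v} < ?S u + ?S v" using pos nn[OF V(1)] nn[OF V(2)] by fastforce
qed

text \<open>Here \<open>k\<close> is the number of raised edges saved in comparison with one per
  deficient vertex; each saved edge lowers the total by 2.\<close>

lemma balanced_completion:
  assumes G: "simple_graph V E" and f: "balanced V E f"
    and D: "D \<subseteq> {e \<in> E. f e = -1}" "card D + k \<le> card (deficient V E f)"
      "\<And>v. v \<in> deficient V E f - X \<Longrightarrow> \<exists>d\<in>D. v \<in> d"
    and X: "\<And>x. x \<in> X \<Longrightarrow> even (degree E x)"
      "\<And>x y. x \<in> X \<Longrightarrow> {x, y} \<in> E \<Longrightarrow> f {x, y} = 1 \<Longrightarrow> even (degree E y) \<and> y \<notin> X"
  shows "\<exists>g. is_SEDF E g \<and> sum g E + 2 * int k + int (card {v \<in> V. vsum E f v = 2})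
    + 2 * int (card {v \<in> V. degree E v = 0}) \<le> int (card V) + int (v_even V E)"
proof -
  note G' = simple_graphD[OF G]
  have "edge_dominating E (raise_on D f)" by (rule edge_dominating_raise_on[OF G f D(1,3) X])
  moreover have "signing E (raise_on D f)" using f by (auto simp: balanced_def intro: signing_raise_on)
  ultimately have "is_SEDF E (raise_on D f)" using is_SEDF_if_edge_dominating[OF G'(2)] by blast
  moreover have "sum (raise_on D f) E = sum f E + 2 * int (card D)"
    using sum_raise_on[OF two_setsD(1)[OF G'(2)] D(1)] .
  ultimately show ?thesis using balanced_sum[OF G f] D(2) by (intro exI[of _ "raise_on D f"]) linarith
qed

lemma finite_deficient: "finite V \<Longrightarrow> finite (deficient V E f)"
  by (simp add: deficient_def)

lemma balanced_cover_all:
  assumes G: "simple_graph V E" and f: "balanced V E f"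
  shows "\<exists>g. is_SEDF E g \<and> sum g E + int (card {v \<in> V. vsum E f v = 2})
    + 2 * int (card {v \<in> V. degree E v = 0}) \<le> int (card V) + int (v_even V E)"
proof -
  have sg: "signing E f" using f by (simp add: balanced_def)
  have "\<exists>D \<subseteq> {e \<in> E. f e = -1}. card D \<le> card (deficient V E f)
      \<and> (\<forall>v\<in>deficient V E f. \<exists>d\<in>D. v \<in> d)"
    by (rule ex_negative_cover[OF sg finite_deficient[OF simple_graphD(1)[OF G]] deficient_less_degree])
  then obtain D where D: "D \<subseteq> {e \<in> E. f e = -1}" "card D \<le> card (deficient V E f)"
      "\<forall>v\<in>deficient V E f. \<exists>d\<in>D. v \<in> d"
    by blast
  have "\<exists>g. is_SEDF E g \<and> sum g E + 2 * int 0 + int (card {v \<in> V. vsum E f v = 2})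
    + 2 * int (card {v \<in> V. degree E v = 0}) \<le> int (card V) + int (v_even V E)"
  proof (rule balanced_completion[OF G f D(1), of 0 "{}"])
    show "card D + 0 \<le> card (deficient V E f)" using D(2) by simp
    show "\<exists>d\<in>D. v \<in> d" if "v \<in> deficient V E f - {}" for v using D(3) that by blast
  qed blast+
  then show ?thesis by simp
qed

lemma balanced_shared_edge:
  assumes G: "simple_graph V E" and f: "balanced V E f"
    and e: "{x, y} \<in> E" "f {x, y} = -1" "x \<in> deficient V E f" "y \<in> deficient V E f"
  shows "\<exists>g. is_SEDF E g \<and> sum g E + 2 \<le> int (card V) + int (v_even V E)"
proof -
  note G' = simple_graphD[OF G]
  have sg: "signing E f" using f by (simp add: balanced_def)
  have xy: "x \<noteq> y" using two_sets_pair[OF G'(2) e(1)] .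
  let ?N = "deficient V E f"
  have fN: "finite ?N" using finite_deficient[OF G'(1)] .
  have "finite (?N - {x, y})" using fN by simp
  moreover have "vsum E f v < int (degree E v)" if "v \<in> ?N - {x, y}" for v
    using deficient_less_degree that by fast
  ultimately have "\<exists>D \<subseteq> {e \<in> E. f e = -1}. card D \<le> card (?N - {x, y})
      \<and> (\<forall>v\<in>?N - {x, y}. \<exists>d\<in>D. v \<in> d)"
    by (rule ex_negative_cover[OF sg])
  then obtain D where D: "D \<subseteq> {e \<in> E. f e = -1}" "card D \<le> card (?N - {x, y})"
      "\<forall>v\<in>?N - {x, y}. \<exists>d\<in>D. v \<in> d"
    by blast
  have "card (?N - {x, y}) + 2 = card ?N"
    using card_Diff_subset[of "{x, y}" ?N] e(3,4) xy card_mono[OF fN, of "{x, y}"] by simp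
  moreover have "card (insert {x, y} D) \<le> card D + 1"
    by (metis Suc_eq_plus1 card.infinite card_insert_disjoint finite_insert insert_absorb le_refl le_SucI le0 le_add1)
  ultimately have c: "card (insert {x, y} D) + 1 \<le> card ?N" using D(2) by simp
  have sub: "insert {x, y} D \<subseteq> {e \<in> E. f e = -1}" using D(1) e by simp
  have cov: "\<exists>d\<in>insert {x, y} D. v \<in> d" if "v \<in> ?N - {}" for v
    using D(3) that by (cases "v \<in> {x, y}") auto
  have "\<exists>g. is_SEDF E g \<and> sum g E + 2 * int 1 + int (card {v \<in> V. vsum E f v = 2})
    + 2 * int (card {v \<in> V. degree E v = 0}) \<le> int (card V) + int (v_even V E)"
    by (rule balanced_completion[OF G f sub c cov]) blast+
  then show ?thesis by force
qed

text \<open>A component of the augmented graph that misses \<open>None\<close> has even vertices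
  only, because an odd vertex would bring its edge to \<open>None\<close>. So any of its vertices
  can be the root.\<close>

lemma obtain_rooted_balanced_signing:
  assumes G: "simple_graph V E"
  obtains f where "balanced V E f"
proof -
  let ?H = "augment E (odd_verts V E)" and ?A = "{v \<in> V. even (degree E v)}"
  have roots: "\<exists>v\<in>?A. Some v \<in> \<Union>Q"
    if Q: "closed_in Q (?H - {})" "Q \<noteq> {}" "None \<notin> \<Union>Q" for Q
  proof -
    note G' = simple_graphD[OF G]
    obtain e where e: "e \<in> Q" using Q(2) by blast
    then have eH: "e \<in> ?H" using Q(1) by (auto simp: closed_in_def)
    moreover have "None \<notin> e" using Q(3) e by blast
    ultimately obtain d where d: "d \<in> E" "e = Some ` d" by (auto simp: augment_def)
    obtain v where v: "v \<in> d" using two_setsD(2)[OF G'(2) d(1)] by fastforce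
    then have vV: "v \<in> V" "Some v \<in> \<Union>Q" using d e G'(3) by auto
    have "even (degree E v)"
    proof (rule ccontr)
      assume "odd (degree E v)"
      then have "{None, Some v} \<in> ?H" using vV(1) by (auto simp: augment_def)
      then have "{None, Some v} \<in> Q" using Q(1) vV(2) unfolding closed_in_def by simp
      then show False using Q(3) by blast
    qed
    then show ?thesis using vV by blast
  qed
  have D: "{} \<subseteq> ?H" "signing {} (\<lambda>_. 1)" by (simp_all add: signing_def)
  obtain f where "signing E f"
    "\<And>v. v \<in> V \<Longrightarrow> odd (degree E v) \<Longrightarrow> vsum E f v = 1 \<or> vsum E f v = -1"
    "\<And>v. v \<in> V \<Longrightarrow> even (degree E v) \<Longrightarrow> vsum E f v = 0 \<or> v \<in> ?A \<and> vsum E f v = 2"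
    "2 * card {v \<in> V. vsum E f v = -1} \<le> v_odd V E"
    by (rule obtain_balanced_signing[OF G refl D vsum_empty roots]) blast+
  then show ?thesis by (intro that[of f]) (simp add: balanced_def)
qed

text \<open>
  The 4-cycle None, u, w, y is signed +, -, +, - in advance, so that both ends of the negative edge uw
  are deficient.
\<close>

lemma SEDF_two_odd_neighbours:
  assumes G: "simple_graph V E"
    and v: "{w, u} \<in> E" "{w, y} \<in> E" "u \<noteq> y" "even (degree E w)" "odd (degree E u)" "odd (degree E y)"
  shows "\<exists>g. is_SEDF E g \<and> sum g E + 2 \<le> int (card V) + int (v_even V E)"
proof -
  note G' = simple_graphD[OF G]
  have fin: "finite E" using G'(2) by (rule two_setsD)
  have V: "w \<in> V" "u \<in> V" "y \<in> V" using v(1,2) G'(3) by auto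
  have ne: "w \<noteq> u" "w \<noteq> y" using v by auto
  define H where "H = augment E (odd_verts V E)"
  define D where "D = {{None, Some u}, {Some u, Some w}, {Some w, Some y}, {Some y, None}}"
  define h :: "'a option set \<Rightarrow> int" where
    "h = (\<lambda>e. if e \<in> {{None, Some u}, {Some w, Some y}} then 1 else -1)"
  \<comment> \<open>\<open>w\<close> is barred from being a root, so that its sum is 0 and it is
    deficient.\<close>
  let ?A = "{v \<in> V. even (degree E v)} - {w}"
  have DH: "D \<subseteq> H"
  proof -
    have "Some ` {w, u} \<in> H" "Some ` {w, y} \<in> H" using v(1,2) unfolding H_def augment_def by blast+
    moreover have "{None, Some u} \<in> H" "{None, Some y} \<in> H" using v V by (auto simp: H_def augment_def)
    ultimately show ?thesis by (simp add: D_def insert_commute)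
  qed
  have sD: "signing D h" by (simp add: signing_def h_def)
  have v0: "vsum D h x = 0" for x
    using ne v(3) by (simp add: D_def h_def vsum_insert doubleton_eq_iff)
  have tH: "two_sets H" unfolding H_def using two_sets_augment[OF G'(2)] G'(1) by simp
  have finH: "finite H" using tH by (rule two_setsD)
  have finD: "finite D" by (simp add: D_def)
  have "even (degree D x)" for x using even_vsum_iff[OF finD sD, of x] v0 by simp
  then have evHD: "even_graph (H - D)"
    using even_graph_augment[OF G] degree_Diff[OF finH DH]
    unfolding H_def[symmetric] even_graph_def by (metis even_add)
  \<comment> \<open>A component of \<open>H - D\<close> without \<open>None\<close> and without a
    permitted root can only have the vertices u, y, w: any other odd vertex keeps its edge to
    \<open>None\<close>. The edges uw and wy belong to \<open>D\<close>, so only uy could remain,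
    and a single edge is not an even graph.\<close>
  have roots: "\<exists>x\<in>?A. Some x \<in> \<Union>Q"
    if Q: "closed_in Q (H - D)" "Q \<noteq> {}" "None \<notin> \<Union>Q" for Q
  proof (rule ccontr)
    assume no: "\<not> ?thesis"
    have QH: "Q \<subseteq> H - D" using Q(1) by (simp add: closed_in_def)
    have sub: "\<Union>Q \<subseteq> {Some u, Some y, Some w}"
    proof
      fix z assume z: "z \<in> \<Union>Q"
      then obtain x where x: "z = Some x" using Q(3) by (cases z) auto
      obtain e where e: "e \<in> Q" "z \<in> e" using z by blast
      then have "e \<in> H" "None \<notin> e" using QH Q(3) by blast+
      then obtain d where "d \<in> E" "e = Some ` d" by (auto simp: H_def augment_def)
      then have xV: "x \<in> V" using e x G'(3) by auto
      have "x \<in> {u, y, w}"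
      proof (rule ccontr)
        assume nx: "x \<notin> {u, y, w}"
        then have "odd (degree E x)" using no z x xV by blast
        then have "{None, Some x} \<in> H" using xV by (auto simp: H_def augment_def)
        moreover have "{None, Some x} \<notin> D" using nx by (simp add: D_def doubleton_eq_iff)
        ultimately have "{None, Some x} \<in> Q" using Q(1) z x unfolding closed_in_def by simp
        then show False using Q(3) by blast
      qed
      then show "z \<in> {Some u, Some y, Some w}" using x by simp
    qed
    have "Q \<subseteq> {{Some u, Some y}}"
    proof
      fix e assume e: "e \<in> Q"
      then have eD: "card e = 2" "e \<notin> D" using two_setsD(2)[OF tH] QH by blast+
      obtain a b where ab: "e = {a, b}" "a \<noteq> b" using eD(1) unfolding card_2_iff by blast
      have "a \<in> {Some u, Some y, Some w}" "b \<in> {Some u, Some y, Some w}" using e sub ab by blast+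
      moreover have "{Some u, Some w} \<in> D" "{Some w, Some u} \<in> D" "{Some w, Some y} \<in> D" "{Some y, Some w} \<in> D"
        by (simp_all add: D_def insert_commute)
      ultimately have "e = {Some u, Some y} \<or> e = {Some y, Some u}" using ab eD(2) by blast
      then show "e \<in> {{Some u, Some y}}" by (simp add: insert_commute)
    qed
    then have "Q = {{Some u, Some y}}" using Q(2) by blast
    then have "degree Q (Some u) = 1" by (simp add: degree_def inc_edges_insert)
    moreover have "even_graph Q" using even_graph_closed_in[OF Q(1) evHD] finH by simp
    ultimately show False by (metis even_graph_def odd_one)
  qed
  obtain f where f: "signing E f" "\<And>e. e \<in> E \<Longrightarrow> Some ` e \<in> D \<Longrightarrow> f e = h (Some ` e)"
    "\<And>v. v \<in> V \<Longrightarrow> odd (degree E v) \<Longrightarrow> vsum E f v = 1 \<or> vsum E f v = -1"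
    "\<And>v. v \<in> V \<Longrightarrow> odd (degree E v) \<Longrightarrow> {None, Some v} \<in> D \<Longrightarrow> vsum E f v = - h {None, Some v}"
    "\<And>v. v \<in> V \<Longrightarrow> even (degree E v) \<Longrightarrow> vsum E f v = 0 \<or> v \<in> ?A \<and> vsum E f v = 2"
    "2 * card {v \<in> V. vsum E f v = -1} \<le> v_odd V E"
    by (rule obtain_balanced_signing[OF G H_def DH sD v0 roots]) blast+
  have "balanced V E f" using f(1,3,5,6) by (auto simp: balanced_def)
  moreover have "vsum E f u = -1" using f(4)[OF V(2) v(5)] by (simp add: D_def h_def)
  then have "u \<in> deficient V E f" using V by (simp add: deficient_def)
  moreover have "vsum E f w = 0" using f(5)[OF V(1) v(4)] by simp
  then have "w \<in> deficient V E f"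
    using V v(1) degree_0_iff[OF fin, of w] by (auto simp: deficient_def)
  moreover have "f {w, u} = -1"
    using f(2)[OF v(1)] ne v(3) by (simp add: D_def h_def doubleton_eq_iff)
  ultimately show ?thesis using balanced_shared_edge[OF G] v(1) by blast
qed

text \<open>This yields two positive edges at a vertex of sum 2.\<close>

lemma vsum_le_card_positive:
  assumes "finite E" "signing E f"
  shows "vsum E f v \<le> int (card {e \<in> inc_edges E v. f e = 1})"
proof -
  have "vsum E f v \<le> (\<Sum>e\<in>inc_edges E v. if f e = 1 then 1 else 0)"
    unfolding vsum_def
    by (rule sum_mono) (use assms(2) in \<open>fastforce simp: signing_def inc_edges_def\<close>)
  then show ?thesis by (simp add: int_card_filter[OF finite_inc_edges[OF assms(1)]])
qed

text \<open>By \<open>few\<close> no even vertex has two odd neighbours. Two roots of sum 2 already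
  save 2. With fewer roots there is an even vertex x of sum 0 whose negative edges avoid the root,
  and the saving is made at x.\<close>

lemma SEDF_few_odd_neighbours:
  assumes G: "simple_graph V E"
    and iso: "\<And>v. v \<in> V \<Longrightarrow> degree E v \<noteq> 0"
    and few: "\<And>w u y. {w, u} \<in> E \<Longrightarrow> {w, y} \<in> E \<Longrightarrow> u \<noteq> y \<Longrightarrow> even (degree E w)
      \<Longrightarrow> odd (degree E u) \<Longrightarrow> even (degree E y)"
    and ev: "v_even V E > 0"
  shows "\<exists>g. is_SEDF E g \<and> sum g E + 2 \<le> int (card V) + int (v_even V E)"
proof -
  note G' = simple_graphD[OF G]
  have fin: "finite E" using G'(2) by (rule two_setsD)
  obtain f where f: "balanced V E f" using obtain_rooted_balanced_signing[OF G] .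
  then have sg: "signing E f" by (simp add: balanced_def)
  let ?R = "{v \<in> V. vsum E f v = 2}" and ?N = "deficient V E f"
  have finR: "finite ?R" using G'(1) by simp
  have fN: "finite ?N" using finite_deficient[OF G'(1)] .
  have zero: "vsum E f v = 0" if "v \<in> V" "even (degree E v)" "v \<notin> ?R" for v
    using f that by (auto simp: balanced_def)
  \<comment> \<open>If x has a positive edge to an odd vertex, then by \<open>few\<close> a negative
    edge xy leads to an even y, which is no root and hence deficient, so one raised edge serves both
    ends. Otherwise all positive edges at x lead to even vertices, which reach sum 2 on their own,
    and x may stay at sum 0.\<close>
  have fromx: ?thesis
    if x: "x \<in> V" "even (degree E x)" "x \<notin> ?R"
      and neg: "\<And>y. {x, y} \<in> E \<Longrightarrow> f {x, y} = -1 \<Longrightarrow> y \<notin> ?R" for x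
  proof -
    have vx: "vsum E f x = 0" using zero x .
    have xN: "x \<in> ?N" using x(1) vx iso by (simp add: deficient_def)
    show ?thesis
    proof (cases "\<exists>z. {x, z} \<in> E \<and> f {x, z} = 1 \<and> odd (degree E z)")
      case True
      then obtain z where z: "{x, z} \<in> E" "f {x, z} = 1" "odd (degree E z)" by blast
      obtain e where e: "e \<in> E" "x \<in> e" "f e = -1"
        using obtain_negative_edge[OF sg deficient_less_degree[OF xN]] by metis
      obtain y where y: "e = {x, y}" using two_sets_obtain[OF G'(2) e(1,2)] by metis
      have "z \<noteq> y" using z(2) e(3) y by auto
      then have ey: "even (degree E y)" using few z(1,3) e(1) y x(2) by blast
      have yV: "y \<in> V" using e(1) y G'(3) by auto
      have "y \<notin> ?R" using neg e y by blast
      then have "vsum E f y = 0" using zero yV ey by blast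
      then have "y \<in> ?N" using yV iso by (simp add: deficient_def)
      then show ?thesis using balanced_shared_edge[OF G f] e y xN by blast
    next
      case False
      have "finite (?N - {x})" using fN by simp
      moreover have "vsum E f v < int (degree E v)" if "v \<in> ?N - {x}" for v
        using deficient_less_degree that by fast
      ultimately have "\<exists>D \<subseteq> {e \<in> E. f e = -1}. card D \<le> card (?N - {x})
          \<and> (\<forall>v\<in>?N - {x}. \<exists>d\<in>D. v \<in> d)"
        by (rule ex_negative_cover[OF sg])
      then obtain D where D: "D \<subseteq> {e \<in> E. f e = -1}" "card D \<le> card (?N - {x})"
          "\<forall>v\<in>?N - {x}. \<exists>d\<in>D. v \<in> d"
        by blast
      have "card D + 1 \<le> card ?N"
        using D(2) card_Suc_Diff1[OF fN xN] by simp
      moreover have "even (degree E y) \<and> y \<notin> {x}" if "x' \<in> {x}" "{x', y} \<in> E" "f {x', y} = 1" for x' y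
        using False that two_sets_pair[OF G'(2)] by blast
      ultimately have "\<exists>g. is_SEDF E g \<and> sum g E + 2 * int 1 + int (card {v \<in> V. vsum E f v = 2})
        + 2 * int (card {v \<in> V. degree E v = 0}) \<le> int (card V) + int (v_even V E)"
        using D(3) x(2) by (intro balanced_completion[OF G f D(1), of 1 "{x}"]) simp_all
      then show ?thesis by force
    qed
  qed
  consider "card ?R \<ge> 2" | "?R = {}" | q where "?R = {q}"
  proof -
    have "card ?R = 0 \<or> card ?R = 1 \<or> card ?R \<ge> 2" by linarith
    moreover have "?R = {}" if "card ?R = 0" using that card_0_eq[OF finR] by blast
    moreover have "\<exists>q. ?R = {q}" if "card ?R = 1" using that card_1_singletonE by blast
    ultimately show thesis using that by blast
  qed
  then show ?thesis
  proof cases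
    case 1
    then show ?thesis using balanced_cover_all[OF G f] by force
  next
    case 2
    have "{v \<in> V. even (degree E v)} \<noteq> {}" using ev unfolding v_even_def by (metis card.empty less_numeral_extra(3))
    then obtain x where "x \<in> V" "even (degree E x)" by blast
    then show ?thesis using fromx[of x] 2 by blast
  next
    case 3
    then have q: "q \<in> V" "vsum E f q = 2" by auto
    let ?P = "{e \<in> inc_edges E q. f e = 1}"
    have "\<not> card ?P \<le> Suc 0" using vsum_le_card_positive[OF fin sg, of q] q(2) by simp
    moreover have "finite ?P" using finite_inc_edges[OF fin] by simp
    ultimately have "\<not> (\<forall>d\<in>?P. \<forall>e\<in>?P. d = e)" using card_le_Suc0_iff_eq[of ?P] by simp
    then obtain e1 e2 where e: "e1 \<in> ?P" "e2 \<in> ?P" "e1 \<noteq> e2" by blast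
    then have e': "e1 \<in> E" "q \<in> e1" "e2 \<in> E" "q \<in> e2" "f e1 = 1" "f e2 = 1" by (auto simp: inc_edges_def)
    obtain a b where ab: "e1 = {q, a}" "e2 = {q, b}"
      using two_sets_obtain[OF G'(2)] e' by metis
    have "even (degree E q)" using even_vsum_iff[OF fin sg, of q] q(2) by simp
    \<comment> \<open>The even one among the two neighbours is the required x: its edge to the only
      root \<open>q\<close> is positive, so its negative edges avoid \<open>q\<close>.\<close>
    then have "even (degree E a) \<or> even (degree E b)"
      using few[of q a b] e' e(3) ab by blast
    then obtain x where x: "{q, x} \<in> E" "f {q, x} = 1" "even (degree E x)"
      using e' ab by blast
    have "x \<noteq> q" using two_sets_pair[OF G'(2) x(1)] by simp
    moreover have "x \<in> V" using x(1) G'(3) by auto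
    moreover have "y \<noteq> q" if "f {x, y} = -1" for y
      using that x(2) by (auto simp: insert_commute)
    ultimately show ?thesis using fromx[of x] x(3) 3 by blast
  qed
qed

lemma SEDF_even_bound:
  assumes G: "simple_graph V E"
  shows "\<exists>g. is_SEDF E g \<and> sum g E \<le> int (card V) + int (v_even V E)"
  using obtain_rooted_balanced_signing[OF G] balanced_cover_all[OF G]
  by (smt (verit) of_nat_0_le_iff)

lemma SEDF_even_bound_improved:
  assumes G: "simple_graph V E" and ev: "v_even V E > 0"
  shows "\<exists>g. is_SEDF E g \<and> sum g E + 2 \<le> int (card V) + int (v_even V E)"
proof (cases "\<exists>v\<in>V. degree E v = 0")
  case True
  obtain f where f: "balanced V E f" using obtain_rooted_balanced_signing[OF G] .
  have "card {v \<in> V. degree E v = 0} \<noteq> 0" using True simple_graphD(1)[OF G] by auto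
  then show ?thesis using balanced_cover_all[OF G f] by force
next
  case False
  note no_isolated = this
  show ?thesis
  proof (cases "\<exists>w u y. {w, u} \<in> E \<and> {w, y} \<in> E \<and> u \<noteq> y \<and> even (degree E w)
      \<and> odd (degree E u) \<and> odd (degree E y)")
    case True
    then show ?thesis using SEDF_two_odd_neighbours[OF G] by blast
  next
    case no: False
    show ?thesis
    proof (rule SEDF_few_odd_neighbours[OF G _ _ ev])
      show "degree E v \<noteq> 0" if "v \<in> V" for v using no_isolated that by simp
      show "even (degree E y)"
        if "{w, u} \<in> E" "{w, y} \<in> E" "u \<noteq> y" "even (degree E w)" "odd (degree E u)" for w u y
        using no that by blast
    qed
  qed
qed

section \<open>The bound with the odd vertices\<close>

lemma edge_dominatingI:
  assumes "signing E f" "\<And>v. v \<in> \<Union>E \<Longrightarrow> vsum E f v \<ge> 0"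
    "\<And>u v. {u, v} \<in> E \<Longrightarrow> f {u, v} = 1 \<Longrightarrow> vsum E f u + vsum E f v \<ge> 2"
  shows "edge_dominating E f"
  unfolding edge_dominating_def
proof (intro allI impI)
  fix u v assume uv: "{u, v} \<in> E"
  then have "u \<in> \<Union>E" "v \<in> \<Union>E" by auto
  then have "vsum E f u \<ge> 0" "vsum E f v \<ge> 0" using assms(2) by blast+
  then show "f {u, v} < vsum E f u + vsum E f v"
    using signingD[OF assms(1) uv] assms(3)[OF uv] by fastforce
qed

lemma edge_dominating_closed_Un:
  assumes K: "closed_in K E"
    and g1: "signing K g1" "edge_dominating K g1"
    and g2: "signing (E - K) g2" "edge_dominating (E - K) g2"
    and fin: "finite E"
  shows "\<exists>g. signing E g \<and> edge_dominating E g \<and> sum g E = sum g1 K + sum g2 (E - K)"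
proof -
  define g where "g e = (if e \<in> K then g1 e else g2 e)" for e
  have KE: "K \<subseteq> E" using K by (simp add: closed_in_def)
  have 1: "vsum E g v = vsum K g1 v" if "v \<in> \<Union>K" for v
    using inc_edges_closed_in[OF K that, symmetric] unfolding vsum_def
    by (auto simp: g_def inc_edges_def intro: sum.cong)
  have 2: "vsum E g v = vsum (E - K) g2 v" if "v \<in> \<Union>(E - K)" for v
    using inc_edges_closed_in[OF closed_in_Diff[OF K] that, symmetric] unfolding vsum_def
    by (auto simp: g_def inc_edges_def intro: sum.cong)
  have "edge_dominating E g"
    unfolding edge_dominating_def
  proof (intro allI impI)
    fix u v assume uv: "{u, v} \<in> E"
    show "g {u, v} < vsum E g u + vsum E g v"
    proof (cases "{u, v} \<in> K")
      case True
      then have "u \<in> \<Union>K" "v \<in> \<Union>K" by auto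
      then show ?thesis using 1 g1(2) True by (simp add: edge_dominating_def g_def)
    next
      case False
      then have "{u, v} \<in> E - K" using uv by simp
      moreover from this have "u \<in> \<Union>(E - K)" "v \<in> \<Union>(E - K)" by blast+
      ultimately show ?thesis using 2 g2(2) False by (simp add: edge_dominating_def g_def)
    qed
  qed
  moreover have "signing E g" using g1(1) g2(1) by (simp add: signing_def g_def)
  moreover have "sum g E = sum g K + sum g (E - K)" by (rule sum.subset_diff[OF KE fin, THEN trans]) simp
  then have "sum g E = sum g1 K + sum g2 (E - K)" by (simp add: g_def)
  ultimately show ?thesis by blast
qed

text \<open>Use greedy signs from a positive edge at \<open>r\<close>, which counts as chosen. If
  the last edge is positive, all chosen vertices have sum 2 and the total is |C|. If it is negative,
  \<open>r\<close> has sum 0 and the total is |C| - 1. When every vertex is chosen this does no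
  harm, since the other end of each edge at \<open>r\<close> has sum 2; otherwise raising a negative
  edge at \<open>r\<close> gives |C| + 1, still at most the number of vertices.\<close>

lemma euler_circuit_dominating:
  assumes E: "two_sets E" and xs: "trail E xs" "hd xs = r" "last xs = r" "length xs \<ge> 2"
    and T: "T = set (trail_edges xs)"
  shows "\<exists>g. signing T g \<and> edge_dominating T g \<and> sum g T \<le> int (card (\<Union>T))"
proof -
  have TE: "T \<subseteq> E" "distinct (trail_edges xs)" using xs(1) by (auto simp: trail_def T)
  have t: "two_sets T" using two_sets_subset[OF E TE(1)] .
  have fin: "finite T" using t by (rule two_setsD)
  have U: "\<Union>T = set xs" using Union_trail_edges_eq[OF xs(4)] T by simp
  have finU: "finite (\<Union>T)" unfolding U by simp
  have rU: "r \<in> \<Union>T" using xs(2,4) unfolding U by (metis hd_in_set list.size(3) not_numeral_le_zero)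
  have "\<exists>g C t. (t = 1 \<or> t = -1) \<and> {r} \<subseteq> C \<and> C \<subseteq> {r} \<union> set xs \<and> (\<forall>e. g e = 1 \<or> g e = -1)
    \<and> (\<forall>v. vsum (set (trail_edges xs)) g v = (if v \<in> C - {r} then 2 else 0)
        + (if v = hd xs then 1 else 0) + (if v = last xs then t else 0))
    \<and> (\<forall>e\<in>set (trail_edges xs). g e = 1 \<longrightarrow> e \<inter> C \<noteq> {})"
    by (rule greedy_signing[OF xs(4) TE(2)]) (use two_setsD(2)[OF t] T xs(3) in auto)
  then obtain g C t where g: "t = 1 \<or> t = -1" "r \<in> C" "C \<subseteq> {r} \<union> set xs" "\<forall>e. g e = 1 \<or> g e = -1"
    "\<forall>v. vsum T g v = (if v \<in> C - {r} then 2 else 0) + (if v = hd xs then 1 else 0)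
      + (if v = last xs then t else 0)"
    "\<forall>e\<in>T. g e = 1 \<longrightarrow> e \<inter> C \<noteq> {}"
    unfolding T by blast
  have v: "vsum T g v = (if v = r then 1 + t else if v \<in> C then 2 else 0)" for v
    using g(5) xs(2,3) by auto
  have CU: "C \<subseteq> \<Union>T" using g(3) rU unfolding U by blast
  have sg: "signing T g" using g(4) by (simp add: signing_def)
  have sum2: "2 * sum g T = 2 * int (card C) - 1 + t"
  proof -
    have "(\<Sum>x\<in>\<Union>T. vsum T g x) = (\<Sum>x\<in>\<Union>T. 2 * (if x \<in> C then 1 else 0) + (if x = r then t - 1 else 0))"
      by (rule sum.cong) (use v g(2) in auto)
    also have "\<dots> = 2 * (\<Sum>x\<in>\<Union>T. if x \<in> C then 1 else 0) + (t - 1)"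
      using finU rU by (simp add: sum.distrib sum_distrib_left sum.delta)
    also have "(\<Sum>x\<in>\<Union>T. if x \<in> C then 1 else 0) = int (card {x \<in> \<Union>T. x \<in> C})"
      using int_card_filter[OF finU] by simp
    also have "{x \<in> \<Union>T. x \<in> C} = C" using CU by auto
    finally show ?thesis using sum_vsum[OF t finU, of g] by simp
  qed
  have cC: "card C \<le> card (\<Union>T)" using CU finU by (rule card_mono[rotated])
  consider "t = 1" | "t = -1" "C = \<Union>T" | "t = -1" "C \<noteq> \<Union>T" using g(1) by blast
  then show ?thesis
  proof cases
    case 1
    have "edge_dominating T g"
    proof (rule edge_dominatingI[OF sg])
      show "vsum T g x \<ge> 0" for x using v 1 by simp
      fix x y assume xy: "{x, y} \<in> T" "g {x, y} = 1"
      then have "{x, y} \<inter> C \<noteq> {}" using g(6) by blast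
      then have "x \<in> C \<or> y \<in> C" by blast
      then show "vsum T g x + vsum T g y \<ge> 2" using v[of x] v[of y] 1 g(2) by auto
    qed
    then show ?thesis using sg sum2 1 cC by (intro exI[of _ g]) simp
  next
    case 2
    have "edge_dominating T g"
    proof (rule edge_dominatingI[OF sg])
      show "vsum T g x \<ge> 0" for x using v 2 by simp
      fix x y assume xy: "{x, y} \<in> T" "g {x, y} = 1"
      then have "x \<noteq> y" "x \<in> C" "y \<in> C" using two_sets_pair[OF t] 2(2) by blast+
      then show "vsum T g x + vsum T g y \<ge> 2" using v[of x] v[of y] 2(1) by auto
    qed
    then show ?thesis using sg sum2 2 cC by (intro exI[of _ g]) simp
  next
    case 3
    have "vsum T g r < int (degree T r)"
      using v[of r] 3 degree_0_iff[OF fin, of r] rU by (cases "degree T r") auto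
    then obtain d where d: "d \<in> T" "r \<in> d" "g d = -1" using obtain_negative_edge[OF sg] by metis
    then have D: "{d} \<subseteq> {e \<in> T. g e = -1}" by simp
    let ?g = "raise_on {d} g"
    note ge = vsum_raise_on_ge[OF fin D]
    have nn: "vsum T g x \<ge> 0" for x using v 3 by simp
    have r2: "vsum T ?g x \<ge> 2" if "x \<in> C" for x
      using ge(1)[of x] ge(2)[of d r] nn[of x] v[of x] d that by (cases "x = r") auto
    have nn': "vsum T ?g x \<ge> 0" for x using nn[of x] ge(1)[of x] by simp
    have "edge_dominating T ?g"
    proof (rule edge_dominatingI[OF signing_raise_on[OF sg] nn'])
      fix x y assume xy: "{x, y} \<in> T" "?g {x, y} = 1"
      have "{x, y} \<inter> C \<noteq> {}"
      proof (cases "{x, y} = d")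
        case True
        then show ?thesis using d(2) g(2) by blast
      next
        case False
        then have "g {x, y} = 1" using xy(2) by (simp add: raise_on_def)
        then show ?thesis using xy(1) g(6) by blast
      qed
      then have "x \<in> C \<or> y \<in> C" by blast
      then show "vsum T ?g x + vsum T ?g y \<ge> 2" using r2[of x] r2[of y] nn'[of x] nn'[of y] by fastforce
    qed
    moreover have "sum ?g T = sum g T + 2" using sum_raise_on[OF fin D] by simp
    moreover have "card C < card (\<Union>T)" using psubset_card_mono[OF finU, of C] CU 3(2) by blast
    ultimately show ?thesis using signing_raise_on[OF sg] sum2 3(1) by (intro exI[of _ ?g]) simp
  qed
qed

text \<open>
  P is the set of odd vertices whose edge to None is positive. After the vertices of P - C are
  repaired, a bad positive edge joins an unchosen even vertex to a vertex of P \<inter> C; repairing the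
  smaller of these two sides stays within the budget. A vertex of P \<inter> C without negative
  edges is a leaf, and its neighbour is repaired instead.
\<close>

lemma dominating_from_chosen:
  assumes G: "simple_graph V E" and sg: "signing E f" and C: "C \<subseteq> V" and P: "P \<subseteq> odd_verts V E"
    and odd: "\<And>v. v \<in> V \<Longrightarrow> odd (degree E v) \<Longrightarrow>
      vsum E f v = (if v \<in> C then 2 else 0) + (if v \<in> P then -1 else 1)"
    and even: "\<And>v. v \<in> V \<Longrightarrow> even (degree E v) \<Longrightarrow> vsum E f v = (if v \<in> C then 2 else 0)"
    and meets: "\<And>e. e \<in> E \<Longrightarrow> f e = 1 \<Longrightarrow> e \<inter> C \<noteq> {}"
  shows "\<exists>g. signing E g \<and> edge_dominating E g \<and> 2 * sum g E \<le> 2 * int (card V) + int (v_odd V E)"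
proof -
  note G' = simple_graphD[OF G]
  have fin: "finite E" using G'(2) by (rule two_setsD)
  let ?S = "vsum E f"
  let ?F = "P - C" and ?Q = "P \<inter> C" and ?U = "{v \<in> V. even (degree E v) \<and> v \<notin> C \<and> degree E v \<noteq> 0}"
  have PV: "P \<subseteq> V" using P by blast
  have finite: "finite C" "finite P" "finite ?U" using finite_subset[OF C G'(1)] finite_subset[OF PV G'(1)] G'(1) by simp_all
  have sum2: "2 * sum f E = 2 * int (card C) - 2 * int (card P) + int (v_odd V E)"
  proof -
    have "(\<Sum>v\<in>V. ?S v) = (\<Sum>v\<in>V. 2 * (if v \<in> C then 1 else 0) - 2 * (if v \<in> P then 1 else 0)
        + (if odd (degree E v) then 1 else 0))"
      by (rule sum.cong) (use odd even P in auto)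
    also have "\<dots> = 2 * int (card {v \<in> V. v \<in> C}) - 2 * int (card {v \<in> V. v \<in> P}) + int (v_odd V E)"
      unfolding v_odd_def int_card_filter[OF G'(1)]
      by (simp only: sum.distrib sum_subtractf sum_distrib_left)
    also have "{v \<in> V. v \<in> C} = C" using C by blast
    also have "{v \<in> V. v \<in> P} = P" using PV by blast
    finally show ?thesis using sum_vsum[OF G'(2,1,3), of f] by simp
  qed
  have cV: "card C + card ?F + card ?U \<le> card V"
  proof -
    have "C \<inter> ?F = {}" "(C \<union> ?F) \<inter> ?U = {}" using P by auto
    then have "card C + card ?F + card ?U = card (C \<union> ?F \<union> ?U)"
      using card_Un_disjoint[of C ?F] card_Un_disjoint[of "C \<union> ?F" ?U] finite
      by (simp del: Un_Diff_cancel)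
    also have "\<dots> \<le> card V" using C PV by (intro card_mono G'(1)) blast
    finally show ?thesis .
  qed
  have cP: "card P = card ?F + card ?Q"
  proof -
    have "card (?F \<union> ?Q) = card ?F + card ?Q" by (rule card_Un_disjoint) (use finite in auto)
    then show ?thesis by (simp add: Un_Diff_Int)
  qed
  have F: "?S v < int (degree E v)" if "v \<in> ?F" for v
    using odd[of v] that P by auto
  \<comment> \<open>The total is |C| - |P| + v_odd/2 with |P| = |F| + |Q|. Repairing
    \<open>M\<close> adds at most 2|F| + 2 min(|U|, |Q|), and twice the minimum is at most |U| +
    |Q|. The result is at most |C| + |F| + |U| + v_odd/2, where C, F, U are disjoint.\<close>
  have suff: ?thesis
    if M: "finite M" "\<And>v. v \<in> M \<Longrightarrow> ?S v < int (degree E v)" "?F \<subseteq> M"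
      and cM: "card M \<le> card ?F + min (card ?U) (card ?Q)"
      and cov: "\<And>a b. {a, b} \<in> E \<Longrightarrow> b \<in> ?Q \<Longrightarrow> ?S a = 0 \<Longrightarrow> a \<in> M \<or> b \<in> M" for M
  proof -
    obtain D where D: "D \<subseteq> {e \<in> E. f e = -1}" "card D \<le> card M" "\<forall>v\<in>M. \<exists>d\<in>D. v \<in> d"
      using ex_negative_cover[OF sg M(1,2)] by blast
    let ?g = "raise_on D f"
    let ?S' = "vsum E ?g"
    note ge = vsum_raise_on_ge[OF fin D(1)]
    have geM: "?S' v \<ge> ?S v + 2" if "v \<in> M" for v using D(3) ge(2) that by blast
    have o: "?S' v \<ge> 1" if "v \<in> V" "odd (degree E v)" for v
    proof (cases "v \<in> ?F")
      case True
      then have "v \<in> M" using M(3) by blast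
      then show ?thesis using geM[of v] odd[OF that] by (auto split: if_splits)
    next
      case False
      then have "?S v \<ge> 1" using odd[OF that] by auto
      then show ?thesis using ge(1)[of v] by simp
    qed
    have e: "?S' v \<ge> 0" if "v \<in> V" "even (degree E v)" for v
      using ge(1)[of v] even[OF that] by (auto split: if_splits)
    have nn: "?S' v \<ge> 0" if "v \<in> V" for v using o[OF that] e[OF that] by fastforce
    \<comment> \<open>A chosen end has sum at least 2 unless it lies in \<open>?Q\<close>, where it
      has sum 1. Then the other end has to contribute 1, which it fails to do only at sum 0;
      \<open>cov\<close> provides a repair for exactly these edges.\<close>
    have pair: "?S' a + ?S' b \<ge> 2" if ab: "{a, b} \<in> E" "b \<in> C" for a b
    proof -
      have V: "a \<in> V" "b \<in> V" using ab(1) G'(3) by auto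
      consider "even (degree E b)" | "odd (degree E b)" "b \<notin> P" | "odd (degree E b)" "b \<in> P" by blast
      then show ?thesis
      proof cases
        case 1
        then show ?thesis using even[OF V(2) 1] ab(2) ge(1)[of b] nn[OF V(1)] by simp
      next
        case 2
        then show ?thesis using odd[OF V(2) 2(1)] ab(2) ge(1)[of b] nn[OF V(1)] by simp
      next
        case 3
        have Sb: "?S b = 1" using odd[OF V(2) 3(1)] ab(2) 3(2) by simp
        show ?thesis
        proof (cases "even (degree E a) \<and> ?S a = 0")
          case True
          then consider "a \<in> M" | "b \<in> M" using cov[OF ab(1)] 3(2) ab(2) by blast
          then show ?thesis
            using True geM[of a] geM[of b] ge(1)[of a] ge(1)[of b] Sb by cases simp_all
        next
          case False
          then have "?S' a \<ge> 1"
            using o[OF V(1)] even[OF V(1)] ge(1)[of a]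
            by (cases "even (degree E a)") (auto split: if_splits)
          then show ?thesis using ge(1)[of b] Sb by simp
        qed
      qed
    qed
    have "edge_dominating E ?g"
    proof (rule edge_dominatingI[OF signing_raise_on[OF sg]])
      show "?S' v \<ge> 0" if "v \<in> \<Union>E" for v using nn G'(3) that by blast
      fix u v assume uv: "{u, v} \<in> E" "?g {u, v} = 1"
      show "?S' u + ?S' v \<ge> 2"
      proof (cases "{u, v} \<in> D")
        case True
        have "?S w \<ge> -1" if "w \<in> V" for w
          using odd[OF that] even[OF that] by (cases "even (degree E w)") auto
        moreover have "u \<in> V" "v \<in> V" using uv(1) G'(3) by auto
        ultimately have "?S u \<ge> -1" "?S v \<ge> -1" by blast+
        then show ?thesis using ge(2)[OF True, of u] ge(2)[OF True, of v] by simp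
      next
        case False
        then have "f {u, v} = 1" using uv(2) by (simp add: raise_on_def)
        then have "{u, v} \<inter> C \<noteq> {}" using meets uv(1) by blast
        then consider "v \<in> C" | "u \<in> C" by blast
        then show ?thesis
        proof cases
          case 1
          then show ?thesis using pair uv(1) by blast
        next
          case 2
          moreover have "{v, u} \<in> E" using uv(1) by (simp add: insert_commute)
          ultimately show ?thesis using pair[of v u] by simp
        qed
      qed
    qed
    moreover have "2 * sum ?g E \<le> 2 * int (card V) + int (v_odd V E)"
      using sum_raise_on[OF fin D(1)] sum2 cV cP cM D(2) by simp
    ultimately show ?thesis using signing_raise_on[OF sg] by blast
  qed
  show ?thesis
  proof (cases "card ?U \<le> card ?Q")
    case True
    show ?thesis
    proof (rule suff[of "?F \<union> ?U"])
      show "finite (?F \<union> ?U)" using finite by simp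
      show "?S v < int (degree E v)" if "v \<in> ?F \<union> ?U" for v
        using F[of v] even[of v] that by auto
      show "card (?F \<union> ?U) \<le> card ?F + min (card ?U) (card ?Q)"
        using True card_Un_le[of ?F ?U] by simp
      fix a b assume ab: "{a, b} \<in> E" "b \<in> ?Q" "?S a = 0"
      have "a \<in> V" using ab(1) G'(3) by auto
      moreover have "degree E a \<noteq> 0" using ab(1) degree_0_iff[OF fin, of a] by auto
      moreover have "even (degree E a)" using even_vsum_iff[OF fin sg, of a] ab(3) by simp
      ultimately show "a \<in> ?F \<union> ?U \<or> b \<in> ?F \<union> ?U" using even[of a] ab(3) by auto
    qed blast
  next
    case False
    let ?B = "{b \<in> ?Q. \<exists>a. {a, b} \<in> E \<and> ?S a = 0}"
    have "\<forall>b\<in>?B. \<exists>m. ?S m < int (degree E m) \<and> (\<forall>a. {a, b} \<in> E \<longrightarrow> ?S a = 0 \<longrightarrow> m = a \<or> m = b)"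
    proof
      fix b assume b: "b \<in> ?B"
      then obtain a where a: "{a, b} \<in> E" "?S a = 0" by blast
      have bd: "b \<in> V" "odd (degree E b)" using b P by auto
      then have Sb: "?S b = 1" using odd[OF bd] b by simp
      show "\<exists>m. ?S m < int (degree E m) \<and> (\<forall>a. {a, b} \<in> E \<longrightarrow> ?S a = 0 \<longrightarrow> m = a \<or> m = b)"
      proof (cases "degree E b = 1")
        case True
        then obtain e where e: "inc_edges E b = {e}" unfolding degree_def using card_1_singletonE by blast
        have "{c, b} = e" if "{c, b} \<in> E" for c
        proof -
          have "{c, b} \<in> inc_edges E b" using that by (simp add: inc_edges_def)
          then show ?thesis using e by blast
        qed
        note same = this
        have "c = a" if "{c, b} \<in> E" for c
        proof -
          have "{c, b} = {a, b}" using same[OF that]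
              same[OF a(1)] by (rule trans[OF _ sym])
          then show ?thesis by (auto simp: doubleton_eq_iff)
        qed
        moreover have "degree E a \<noteq> 0" using a(1) degree_0_iff[OF fin, of a] by auto
        ultimately show ?thesis using a(2) by (intro exI[of _ a]) auto
      next
        case False
        then have "degree E b > 1" using bd(2) by (cases "degree E b") auto
        then show ?thesis using Sb by (intro exI[of _ b]) simp
      qed
    qed
    from bchoice[OF this] obtain m where
      m': "\<forall>b\<in>?B. ?S (m b) < int (degree E (m b)) \<and> (\<forall>a. {a, b} \<in> E \<longrightarrow> ?S a = 0 \<longrightarrow> m b = a \<or> m b = b)" ..
    have m: "?S (m b) < int (degree E (m b))" "{a, b} \<in> E \<Longrightarrow> ?S a = 0 \<Longrightarrow> m b = a \<or> m b = b"
      if "b \<in> ?B" for a b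
      using m'[rule_format, OF that] by simp_all
    have finB: "finite ?B" "finite ?Q" using finite by simp_all
    show ?thesis
    proof (rule suff[of "?F \<union> m ` ?B"])
      show "finite (?F \<union> m ` ?B)" using finite finB by simp
      show "?S v < int (degree E v)" if "v \<in> ?F \<union> m ` ?B" for v
        using F[of v] m(1) that by blast
      have "card (m ` ?B) \<le> card ?Q"
        using card_image_le[OF finB(1), of m] card_mono[OF finB(2), of ?B] by fastforce
      then show "card (?F \<union> m ` ?B) \<le> card ?F + min (card ?U) (card ?Q)"
        using False card_Un_le[of ?F "m ` ?B"] by simp
      fix a b assume ab: "{a, b} \<in> E" "b \<in> ?Q" "?S a = 0"
      then have b: "b \<in> ?B" by blast
      then have "m b \<in> m ` ?B" by (rule imageI)
      moreover have "m b = a \<or> m b = b" using m(2)[OF b ab(1,3)] .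
      ultimately show "a \<in> ?F \<union> m ` ?B \<or> b \<in> ?F \<union> m ` ?B" by auto
    qed blast
  qed
qed

text \<open>By \<open>no\<close> every component with an edge has an odd vertex, so in the augmented
  graph all edges hang together through \<open>None\<close> and a single Euler circuit covers
  them.\<close>

lemma dominating_single_circuit:
  assumes G: "simple_graph V E" and ne: "E \<noteq> {}"
    and no: "\<And>Q. closed_in Q E \<Longrightarrow> Q \<noteq> {} \<Longrightarrow> \<not> even_graph Q"
  shows "\<exists>g. signing E g \<and> edge_dominating E g \<and> 2 * sum g E \<le> 2 * int (card V) + int (v_odd V E)"
proof -
  note G' = simple_graphD[OF G]
  have fin: "finite E" using G'(2) by (rule two_setsD)
  let ?W = "odd_verts V E"
  define H where "H = augment E ?W"
  have tH: "two_sets H" unfolding H_def using two_sets_augment[OF G'(2)] G'(1) by simp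
  have evH: "even_graph H" unfolding H_def using even_graph_augment[OF G] .
  have inV: "v \<in> V" if "degree E v \<noteq> 0" for v using that degree_0_iff[OF fin, of v] G'(3) by auto
  have "closed_in E E" by (auto simp: closed_in_def)
  then obtain w where "odd (degree E w)" using no[of E] ne by (auto simp: even_graph_def)
  moreover from this have "w \<in> V" using inV[of w] by (metis even_zero)
  ultimately have "{None, Some w} \<in> H" by (auto simp: H_def augment_def)
  then have NH: "None \<in> \<Union>H" by blast
  obtain xs where xs: "trail H xs" "hd xs = None" "last xs = None" "length xs \<ge> 2"
    "closed_in (set (trail_edges xs)) H" "None \<in> \<Union>(set (trail_edges xs))"
    using obtain_euler_circuit[OF tH evH NH] by metis
  let ?T = "set (trail_edges xs)"
  have TH: "?T \<subseteq> H" "distinct (trail_edges xs)" using xs(1) by (auto simp: trail_def)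
  \<comment> \<open>Edges of \<open>H\<close> off the circuit would miss \<open>None\<close>, hence
    be edges of \<open>E\<close> between even vertices, and form an even union of components of
    \<open>E\<close>.\<close>
  have HT: "?T = H"
  proof (rule ccontr)
    assume neq: "?T \<noteq> H"
    define R where "R = H - ?T"
    have R: "closed_in R H" unfolding R_def using closed_in_Diff[OF xs(5)] .
    have NR: "None \<notin> \<Union>R" unfolding R_def using closed_in_disjoint[OF xs(5)] xs(6) by blast
    define Q where "Q = {e \<in> E. Some ` e \<in> R}"
    have UQ: "Some v \<in> \<Union>R" if "v \<in> \<Union>Q" for v using that by (auto simp: Q_def)
    have "closed_in Q E"
      unfolding closed_in_def
    proof (intro conjI ballI impI)
      show "Q \<subseteq> E" by (auto simp: Q_def)
      fix e assume e: "e \<in> E" "e \<inter> \<Union>Q \<noteq> {}"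
      then obtain v where "v \<in> e" "v \<in> \<Union>Q" by blast
      then have "Some ` e \<inter> \<Union>R \<noteq> {}" using UQ by blast
      moreover have "Some ` e \<in> H" using e(1) by (auto simp: H_def augment_def)
      ultimately have "Some ` e \<in> R" using R by (simp add: closed_in_def)
      then show "e \<in> Q" using e(1) by (simp add: Q_def)
    qed
    moreover have "Q \<noteq> {}"
    proof -
      obtain e where e: "e \<in> R" "e \<in> H" using neq TH(1) by (auto simp: R_def)
      then have "None \<notin> e" using NR by blast
      then obtain d where "d \<in> E" "e = Some ` d" using e(2) by (auto simp: H_def augment_def)
      then show ?thesis using e(1) by (auto simp: Q_def)
    qed
    moreover have "even (degree Q v)" for v
    proof (cases "v \<in> \<Union>Q")
      case True
      have "{None, Some v} \<notin> H"
      proof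
        assume "{None, Some v} \<in> H"
        then have "{None, Some v} \<in> R" using R UQ[OF True] unfolding closed_in_def by simp
        then show False using NR by blast
      qed
      then have "v \<notin> ?W" unfolding H_def augment_def by blast
      then have "even (degree E v)" using inV[of v] by (cases "degree E v = 0") auto
      then show ?thesis
        using inc_edges_closed_in[OF \<open>closed_in Q E\<close> True] by (simp add: degree_def)
    next
      case False
      moreover have "finite Q" using fin by (simp add: Q_def)
      ultimately show ?thesis using degree_0_iff[of Q v] by simp
    qed
    then have "even_graph Q" by (simp add: even_graph_def)
    ultimately show False using no by blast
  qed
  \<comment> \<open>\<open>None\<close> counts as chosen from the start and takes the defect of the
    closing edge, so all other sums are 0 or 2. An edge of \<open>E\<close> misses
    \<open>None\<close>, so if it is positive, its chosen end is a vertex of the graph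
    itself.\<close>
  have "\<exists>g C t. (t = 1 \<or> t = -1) \<and> {None} \<subseteq> C \<and> C \<subseteq> {None} \<union> set xs \<and> (\<forall>e. g e = 1 \<or> g e = -1)
    \<and> (\<forall>v. vsum ?T g v = (if v \<in> C - {None} then 2 else 0)
        + (if v = hd xs then 1 else 0) + (if v = last xs then t else 0))
    \<and> (\<forall>e\<in>?T. g e = 1 \<longrightarrow> e \<inter> C \<noteq> {})"
    by (rule greedy_signing[OF xs(4) TH(2)]) (use two_setsD(2)[OF tH] HT xs(3) in auto)
  then obtain g C t where g: "C \<subseteq> {None} \<union> set xs" "\<forall>e. g e = 1 \<or> g e = -1"
    "\<forall>v. vsum H g v = (if v \<in> C - {None} then 2 else 0)
      + (if v = hd xs then 1 else 0) + (if v = last xs then t else 0)"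
    "\<forall>e\<in>H. g e = 1 \<longrightarrow> e \<inter> C \<noteq> {}"
    unfolding HT by blast
  have gS: "vsum H g (Some v) = (if Some v \<in> C then 2 else 0)" for v
    using g(3) xs(2,3) by simp
  define f where "f = (\<lambda>e. g (Some ` e))"
  have S: "vsum E f v = (if Some v \<in> C then 2 else 0) - (if v \<in> ?W then g {None, Some v} else 0)" for v
    using vsum_augment_Some[OF fin, of ?W g v] gS[of v] by (simp add: H_def f_def)
  have CV: "v \<in> V" if "Some v \<in> C" for v
  proof -
    have "Some v \<in> set xs" using g(1) that by blast
    then have "Some v \<in> \<Union>H" using Union_trail_edges_eq[OF xs(4)] HT by simp
    then obtain e where "e \<in> H" "Some v \<in> e" by blast
    then consider d where "d \<in> E" "e = Some ` d" | w where "w \<in> ?W" "e = {None, Some w}"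
      unfolding H_def augment_def by blast
    then show ?thesis using \<open>Some v \<in> e\<close> G'(3) by cases auto
  qed
  show ?thesis
  proof (rule dominating_from_chosen[OF G, of f "{v. Some v \<in> C}" "{v \<in> ?W. g {None, Some v} = 1}"])
    show "signing E f" using g(2) by (simp add: signing_def f_def)
    show "{v. Some v \<in> C} \<subseteq> V" using CV by blast
    show "{v \<in> ?W. g {None, Some v} = 1} \<subseteq> ?W" by blast
    show "vsum E f v = (if v \<in> {v. Some v \<in> C} then 2 else 0)
        + (if v \<in> {v \<in> ?W. g {None, Some v} = 1} then -1 else 1)" if "v \<in> V" "odd (degree E v)" for v
      using S[of v] that g(2)[rule_format, of "{None, Some v}"] by auto
    show "vsum E f v = (if v \<in> {v. Some v \<in> C} then 2 else 0)" if "v \<in> V" "even (degree E v)" for v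
      using S[of v] that by simp
    show "e \<inter> {v. Some v \<in> C} \<noteq> {}" if "e \<in> E" "f e = 1" for e
    proof -
      have "Some ` e \<in> H" using that(1) by (auto simp: H_def augment_def)
      then have "Some ` e \<inter> C \<noteq> {}" using g(4) that(2) by (simp add: f_def)
      then show ?thesis by blast
    qed
  qed
qed

text \<open>A component with even degrees is settled by its own circuit at a cost of at most its
  number of vertices, and these vertices leave \<open>V\<close>. The degrees outside it do not
  change, so the number of odd vertices does not grow.\<close>

lemma dominating_odd_bound:
  assumes "simple_graph V E"
  shows "\<exists>g. signing E g \<and> edge_dominating E g \<and> 2 * sum g E \<le> 2 * int (card V) + int (v_odd V E)"
  using assms
proof (induction "card E" arbitrary: V E rule: less_induct)
  case less
  note G = less.prems
  note G' = simple_graphD[OF G]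
  have fin: "finite E" using G'(2) by (rule two_setsD)
  show ?case
  proof (cases "E = {}")
    case True
    then show ?thesis by (auto simp: signing_def edge_dominating_def)
  next
    case ne: False
    show ?thesis
    proof (cases "\<exists>Q. closed_in Q E \<and> Q \<noteq> {} \<and> even_graph Q")
      case False
      then show ?thesis using dominating_single_circuit[OF G ne] by blast
    next
      case True
      then obtain Q where Q: "closed_in Q E" "Q \<noteq> {}" "even_graph Q" by blast
      have tQ: "two_sets Q" using two_sets_subset[OF G'(2)] Q(1) by (auto simp: closed_in_def)
      obtain e where e: "e \<in> Q" using Q(2) by blast
      then obtain r where "r \<in> e" using two_setsD(2)[OF tQ] by fastforce
      then have "r \<in> \<Union>Q" using e by blast
      then obtain xs where xs: "trail Q xs" "hd xs = r" "last xs = r" "length xs \<ge> 2"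
        "closed_in (set (trail_edges xs)) Q" "r \<in> \<Union>(set (trail_edges xs))"
        using obtain_euler_circuit[OF tQ Q(3)] by metis
      define K where "K = set (trail_edges xs)"
      have K: "closed_in K E" using closed_in_trans xs(5) Q(1) unfolding K_def by blast
      then have KE: "K \<subseteq> E" by (simp add: closed_in_def)
      obtain g1 where g1: "signing K g1" "edge_dominating K g1" "sum g1 K \<le> int (card (\<Union>K))"
        using euler_circuit_dominating[OF tQ xs(1-4) K_def] by blast
      have UK: "\<Union>K \<subseteq> V" using KE G'(3) by blast
      have disj: "\<Union>K \<inter> \<Union>(E - K) = {}" using closed_in_disjoint[OF K] .
      have "K \<noteq> {}" using xs(6) by (auto simp: K_def)
      then have "E - K \<subset> E" using KE by blast
      then have c: "card (E - K) < card E" using fin by (rule psubset_card_mono[rotated])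
      have "simple_graph (V - \<Union>K) (E - K)"
        using G disj unfolding simple_graph_def by blast
      from less.hyps[OF c this] obtain g2 where g2: "signing (E - K) g2" "edge_dominating (E - K) g2"
        "2 * sum g2 (E - K) \<le> 2 * int (card (V - \<Union>K)) + int (v_odd (V - \<Union>K) (E - K))"
        by blast
      obtain g where g: "signing E g" "edge_dominating E g" "sum g E = sum g1 K + sum g2 (E - K)"
        using edge_dominating_closed_Un[OF K g1(1,2) g2(1,2) fin] by blast
      have "degree (E - K) v = degree E v" if "v \<notin> \<Union>K" for v
        using degree_Diff[OF fin KE, of v] degree_0_iff[OF finite_subset[OF KE fin], of v] that by simp
      then have "odd_verts (V - \<Union>K) (E - K) \<subseteq> odd_verts V E" by auto
      then have "v_odd (V - \<Union>K) (E - K) \<le> v_odd V E"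
        unfolding v_odd_def using G'(1) by (intro card_mono) auto
      moreover have "card (V - \<Union>K) + card (\<Union>K) = card V"
        using card_Diff_subset[OF finite_subset[OF UK G'(1)] UK] card_mono[OF G'(1) UK] by simp
      ultimately have "2 * sum g E \<le> 2 * int (card V) + int (v_odd V E)"
        using g1(3) g2(3) g(3) by linarith
      then show ?thesis using g by blast
    qed
  qed
qed

section \<open>Combination of the two bounds\<close>

theorem theorem1p1:
  fixes V :: "'a set" and E :: "'a set set"
  assumes "simple_graph V E" and "V \<noteq> {}"
  shows "real_of_int (signed_edge_dom_num E) \<le> real (card V) + real (v_odd V E) / 2
       \<and> (v_even V E > 0 \<longrightarrow>
           signed_edge_dom_num E \<le> int (card V) - 2 + int (v_even V E))
       \<and> real_of_int (signed_edge_dom_num E) \<le> (4 * real (card V) - 2) / 3"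
proof -
  note G' = simple_graphD[OF assms(1)]
  have fin: "finite E" using G'(2) by (rule two_setsD)
  let ?\<gamma> = "signed_edge_dom_num E"
  obtain g where g: "signing E g" "edge_dominating E g" "2 * sum g E \<le> 2 * int (card V) + int (v_odd V E)"
    using dominating_odd_bound[OF assms(1)] by blast
  have "?\<gamma> \<le> sum g E"
    using signed_edge_dom_num_le[OF fin is_SEDF_if_edge_dominating[OF G'(2) g(1,2)]] .
  then have a: "2 * ?\<gamma> \<le> 2 * int (card V) + int (v_odd V E)" using g(3) by linarith
  have b: "?\<gamma> \<le> int (card V) - 2 + int (v_even V E)" if ev: "v_even V E > 0"
  proof -
    obtain h where h: "is_SEDF E h" "sum h E + 2 \<le> int (card V) + int (v_even V E)"
      using SEDF_even_bound_improved[OF assms(1) ev] by blast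
    then show ?thesis using signed_edge_dom_num_le[OF fin h(1)] by linarith
  qed
  have n: "v_odd V E + v_even V E = card V" using card_odd_even[OF G'(1)] .
  \<comment> \<open>If there are even vertices, adding \<open>a\<close> and \<open>b\<close> gives
    3n - 2 + v_odd + v_even = 4n - 2.\<close>
  have c: "3 * ?\<gamma> \<le> 4 * int (card V) - 2"
  proof (cases "v_even V E > 0")
    case True
    then show ?thesis using a b n by linarith
  next
    case False
    obtain h where h: "is_SEDF E h" "sum h E \<le> int (card V) + int (v_even V E)"
      using SEDF_even_bound[OF assms(1)] by blast
    then have "?\<gamma> \<le> int (card V)" using signed_edge_dom_num_le[OF fin h(1)] False by linarith
    moreover have "even (card V)"
      using even_card_odd_vertices[OF G'(2,1,3)] n False by (simp add: v_odd_def)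
    moreover have "card V \<noteq> 0" using assms(2) G'(1) by simp
    ultimately have "card V \<ge> 2" "?\<gamma> \<le> int (card V)" by (auto elim!: evenE)
    then show ?thesis by linarith
  qed
  have "2 * real_of_int ?\<gamma> \<le> 2 * real (card V) + real (v_odd V E)"
    using of_int_le_iff[where 'a = real, THEN iffD2, OF a] by simp
  moreover have "3 * real_of_int ?\<gamma> \<le> 4 * real (card V) - 2"
    using of_int_le_iff[where 'a = real, THEN iffD2, OF c] by simp
  ultimately show ?thesis using b by auto
qed

end
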